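(* Let $n$ be a positive integer, let $V=\mathbb C^3$, and let $V_{a,b}$ denote the irreducible $SL(3,\mathbb C)$-representation with highest weight $a\omega_1+b\omega_2$. Then there is a natural isomorphism of vector spaces $$\mathcal W_n\simeq\bigoplus_{r_1,\dots,r_n\ge0}\left(V_{r_1+3,r_1}\otimes\cdots\otimes V_{r_n+3,r_n}\right)^{SL(3,\mathbb C)}.$$
   Context: $\omega_1,\omega_2$ are the fundamental weights of $SL(3,\mathbb C)$, with $V_{1,0}=V=\mathbb C^3$ and $V_{0,1}=V^*$. $\mathcal M_n=\{(A_i,\ell_i)_{i=1}^n\in(\mathbb C^3\oplus(\mathbb C^3)^* )^n\mid \ell_iA_i=0,\ i=1,\dots,n\}$, with coordinate ring $\mathbb C[\mathcal M_n]$. $SL(3,\mathbb C)$ acts by $A_i\mapsto GA_i$, $\ell_i\mapsto\ell_iG^{-1}$, and $\mathbb T_n=(\mathbb C^\times)^n$ acts by $A_i\mapsto t_iA_i$, $\ell_i\mapsto t_i^{-1}\ell_i$. Define $$\mathcal W_n=\{H\in\mathbb C[\mathcal M_n]^{SL(3,\mathbb C)}\mid H(\mathbf t\cdot z)=(t_1\cdots t_n)^{-3}H(z)\ \ \forall\,\mathbf t=(t_1,\dots,t_n)\in\mathbb T_n\}.$$ *)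

theory Defs
  imports "HOL-Analysis.Analysis" "HOL-Library.Function_Algebras"
begin

section \<open>Linear algebra on carriers\<close>

text \<open>Vector spaces are subspaces of an ambient type, so that the spaces of an indexed family may
  have different dimensions. Function spaces carry the pointwise structure.\<close>

definition pointwise :: "(complex \<Rightarrow> 'b \<Rightarrow> 'b) \<Rightarrow> complex \<Rightarrow> ('x \<Rightarrow> 'b) \<Rightarrow> 'x \<Rightarrow> 'b" where
  "pointwise s c f = (\<lambda>x. s c (f x))"

abbreviation fscale :: "complex \<Rightarrow> ('x \<Rightarrow> complex) \<Rightarrow> 'x \<Rightarrow> complex" where
  "fscale \<equiv> pointwise (*)"

definition linear_on ::
  "(complex \<Rightarrow> 'a \<Rightarrow> 'a) \<Rightarrow> (complex \<Rightarrow> 'b \<Rightarrow> 'b) \<Rightarrow> 'a::ab_group_add set \<Rightarrow> ('a \<Rightarrow> 'b::ab_group_add) \<Rightarrow> bool"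
where
  "linear_on s1 s2 U f \<longleftrightarrow>
     (\<forall>x\<in>U. \<forall>y\<in>U. f (x + y) = f x + f y) \<and> (\<forall>c. \<forall>x\<in>U. f (s1 c x) = s2 c (f x))"

definition linear_iso ::
  "(complex \<Rightarrow> 'a \<Rightarrow> 'a) \<Rightarrow> (complex \<Rightarrow> 'b \<Rightarrow> 'b) \<Rightarrow> 'a::ab_group_add set \<Rightarrow> 'b::ab_group_add set \<Rightarrow> ('a \<Rightarrow> 'b) \<Rightarrow> bool"
where
  "linear_iso s1 s2 U W f \<longleftrightarrow> linear_on s1 s2 U f \<and> bij_betw f U W"

definition direct_sum :: "('r \<Rightarrow> 'a::zero set) \<Rightarrow> ('r \<Rightarrow> 'a) set" where
  "direct_sum U = {x. (\<forall>r. x r \<in> U r) \<and> finite {r. x r \<noteq> 0}}"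


section \<open>Finite tensor products\<close>

definition multilinear_form ::
  "(complex \<Rightarrow> 'v \<Rightarrow> 'v) \<Rightarrow> ('n \<Rightarrow> 'v::ab_group_add set) \<Rightarrow> (('n \<Rightarrow> 'v) \<Rightarrow> complex) \<Rightarrow> bool"
where
  "multilinear_form sc V \<beta> \<longleftrightarrow>
     (\<forall>v i. (\<forall>j. v j \<in> V j) \<longrightarrow> linear_on sc (*) (V i) (\<lambda>x. \<beta> (v(i := x))))"

text \<open>The tensor product of the \<open>V i\<close> is realised as the span of the pure tensors, a pure tensor
  being the evaluation functional \<open>\<beta> \<mapsto> \<beta> v\<close> on multilinear forms. Over a field multilinear
  forms separate the points of the tensor product, so this is a model of it.\<close>

type_synonym ('n, 'v) tensor = "(('n \<Rightarrow> 'v) \<Rightarrow> complex) \<Rightarrow> complex"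

definition pure_tensor ::
  "(complex \<Rightarrow> 'v \<Rightarrow> 'v) \<Rightarrow> ('n \<Rightarrow> 'v::ab_group_add set) \<Rightarrow> ('n \<Rightarrow> 'v) \<Rightarrow> ('n, 'v) tensor"
where
  "pure_tensor sc V v = (\<lambda>\<beta>. if multilinear_form sc V \<beta> then \<beta> v else 0)"

definition tensor_product ::
  "(complex \<Rightarrow> 'v \<Rightarrow> 'v) \<Rightarrow> ('n::finite \<Rightarrow> 'v::ab_group_add set) \<Rightarrow> ('n, 'v) tensor set"
where
  "tensor_product sc V = module.span fscale {pure_tensor sc V v | v. \<forall>i. v i \<in> V i}"

text \<open>On pure tensors this is \<open>v\<^sub>1 \<otimes> \<dots> \<otimes> v\<^sub>n \<mapsto> g v\<^sub>1 \<otimes> \<dots> \<otimes> g v\<^sub>n\<close>.\<close>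

definition tensor_action ::
  "('n \<Rightarrow> 'g \<Rightarrow> 'v \<Rightarrow> 'v) \<Rightarrow> 'g \<Rightarrow> ('n, 'v) tensor \<Rightarrow> ('n, 'v) tensor"
where
  "tensor_action \<rho> g T = (\<lambda>\<beta>. T (\<lambda>v. \<beta> (\<lambda>i. \<rho> i g (v i))))"


section \<open>Polynomial functions and coordinate rings\<close>

inductive_set poly_funs :: "('x \<Rightarrow> complex) set \<Rightarrow> ('x \<Rightarrow> complex) set"
  for C :: "('x \<Rightarrow> complex) set" where
  const: "(\<lambda>_. c) \<in> poly_funs C"
| coord: "f \<in> C \<Longrightarrow> f \<in> poly_funs C"
| add: "f \<in> poly_funs C \<Longrightarrow> g \<in> poly_funs C \<Longrightarrow> (\<lambda>x. f x + g x) \<in> poly_funs C"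
| mult: "f \<in> poly_funs C \<Longrightarrow> g \<in> poly_funs C \<Longrightarrow> (\<lambda>x. f x * g x) \<in> poly_funs C"

text \<open>Restrictions to \<open>M\<close> of polynomial functions in the coordinates \<open>C\<close>. A function on \<open>M\<close> is
  represented by its extension by zero.\<close>

definition coordinate_ring :: "('x \<Rightarrow> complex) set \<Rightarrow> 'x set \<Rightarrow> ('x \<Rightarrow> complex) set" where
  "coordinate_ring C M =
     {f. (\<exists>p\<in>poly_funs C. \<forall>z\<in>M. f z = p z) \<and> (\<forall>z. z \<notin> M \<longrightarrow> f z = 0)}"


section \<open>Irreducible representations of \<open>SL(3, \<complex>)\<close>\<close>

definition SL3 :: "(complex^3^3) set" where
  "SL3 = {g. det g = 1}"

definition invariants ::
  "(complex^3^3 \<Rightarrow> 'a \<Rightarrow> 'a) \<Rightarrow> 'a set \<Rightarrow> 'a set"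
where
  "invariants \<rho> U = {x \<in> U. \<forall>g\<in>SL3. \<rho> g x = x}"

text \<open>Finite-dimensional rational representations: all matrix coefficients are regular functions
  on the group.\<close>

definition SL3_representation ::
  "(complex \<Rightarrow> 'v \<Rightarrow> 'v) \<Rightarrow> 'v::ab_group_add set \<Rightarrow> (complex^3^3 \<Rightarrow> 'v \<Rightarrow> 'v) \<Rightarrow> bool"
where
  "SL3_representation sc V \<rho> \<longleftrightarrow>
     module.subspace sc V \<and>
     (\<exists>B. finite B \<and> module.span sc B = V) \<and>
     (\<forall>g\<in>SL3. linear_on sc sc V (\<rho> g) \<and> \<rho> g ` V \<subseteq> V) \<and>
     (\<forall>v\<in>V. \<rho> (mat 1) v = v) \<and>
     (\<forall>g\<in>SL3. \<forall>h\<in>SL3. \<forall>v\<in>V. \<rho> (g ** h) v = \<rho> g (\<rho> h v)) \<and>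
     (\<forall>\<xi>. linear_on sc (*) V \<xi> \<longrightarrow>
        (\<forall>v\<in>V. \<exists>p\<in>poly_funs {\<lambda>g. g $ i $ j | i j. True}. \<forall>g\<in>SL3. \<xi> (\<rho> g v) = p g))"

definition irreducible_representation ::
  "(complex \<Rightarrow> 'v \<Rightarrow> 'v) \<Rightarrow> 'v::ab_group_add set \<Rightarrow> (complex^3^3 \<Rightarrow> 'v \<Rightarrow> 'v) \<Rightarrow> bool"
where
  "irreducible_representation sc V \<rho> \<longleftrightarrow>
     SL3_representation sc V \<rho> \<and> V \<noteq> {0} \<and>
     (\<forall>U. module.subspace sc U \<and> U \<subseteq> V \<and> (\<forall>g\<in>SL3. \<rho> g ` U \<subseteq> U) \<longrightarrow> U = {0} \<or> U = V)"

text \<open>The numerals \<open>1, 2, 3\<close> index rows and columns; the order of the index type is not used,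
  because there \<open>3 = 0\<close> is the least element.\<close>

definition borel_subgroup :: "(complex^3^3) set" where
  "borel_subgroup = {g \<in> SL3. g $ 2 $ 1 = 0 \<and> g $ 3 $ 1 = 0 \<and> g $ 3 $ 2 = 0}"

text \<open>A highest weight vector of weight \<open>a \<omega>\<^sub>1 + b \<omega>\<^sub>2\<close> is fixed by the unipotent upper triangular
  matrices, and diagonal matrices scale it by the weight, where \<open>\<omega>\<^sub>1 = t\<^sub>1\<close> and \<open>\<omega>\<^sub>2 = t\<^sub>1 t\<^sub>2\<close>.
  Thus \<open>(a, b) = (1, 0)\<close> is \<open>\<complex>\<^sup>3\<close> and \<open>(a, b) = (0, 1)\<close> is its dual.\<close>

definition has_highest_weight ::
  "(complex \<Rightarrow> 'v \<Rightarrow> 'v) \<Rightarrow> 'v::ab_group_add set \<Rightarrow> (complex^3^3 \<Rightarrow> 'v \<Rightarrow> 'v) \<Rightarrow> nat \<Rightarrow> nat \<Rightarrow> bool"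
where
  "has_highest_weight sc V \<rho> a b \<longleftrightarrow>
     (\<exists>v\<in>V. v \<noteq> 0 \<and>
        (\<forall>g\<in>borel_subgroup. \<rho> g v = sc ((g $ 1 $ 1) ^ a * (g $ 1 $ 1 * g $ 2 $ 2) ^ b) v))"


definition tensor_invariants ::
  "(complex \<Rightarrow> 'v \<Rightarrow> 'v) \<Rightarrow> ('n::finite \<Rightarrow> 'v::ab_group_add set) \<Rightarrow> ('n \<Rightarrow> complex^3^3 \<Rightarrow> 'v \<Rightarrow> 'v)
    \<Rightarrow> ('n, 'v) tensor set"
where
  "tensor_invariants sc V \<rho> = invariants (tensor_action \<rho>) (tensor_product sc V)"


section \<open>The variety \<open>\<M>\<^sub>n\<close> and the space \<open>\<W>\<^sub>n\<close>\<close>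

text \<open>Pairs \<open>(A, \<ell>)\<close> of a column vector and a row vector.\<close>

type_synonym vec_covec = "(complex^3) \<times> (complex^3)"

definition incidence :: "vec_covec set" where
  "incidence = {(A, l). (\<Sum>k\<in>UNIV. l $ k * A $ k) = 0}"

definition pair_coords :: "(vec_covec \<Rightarrow> complex) set" where
  "pair_coords = {\<lambda>z. fst z $ k | k. True} \<union> {\<lambda>z. snd z $ k | k. True}"

definition pair_action :: "complex^3^3 \<Rightarrow> vec_covec \<Rightarrow> vec_covec" where
  "pair_action g z = (g *v fst z, snd z v* matrix_inv g)"

text \<open>The number of pairs is \<open>n = CARD('n)\<close>.\<close>

definition Mvar :: "(vec_covec^'n::finite) set" where
  "Mvar = {z. \<forall>i. z $ i \<in> incidence}"

definition Mvar_coords :: "(vec_covec^'n::finite \<Rightarrow> complex) set" where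
  "Mvar_coords = {\<lambda>z. f (z $ i) | f i. f \<in> pair_coords}"

definition group_action :: "complex^3^3 \<Rightarrow> vec_covec^'n \<Rightarrow> vec_covec^'n" where
  "group_action g z = (\<chi> i. pair_action g (z $ i))"

definition torus_action :: "('n \<Rightarrow> complex) \<Rightarrow> vec_covec^'n \<Rightarrow> vec_covec^'n" where
  "torus_action t z = (\<chi> i. (t i *s fst (z $ i), inverse (t i) *s snd (z $ i)))"

definition Wspace :: "(vec_covec^'n::finite \<Rightarrow> complex) set" where
  "Wspace = {H \<in> coordinate_ring Mvar_coords Mvar.
     (\<forall>g\<in>SL3. \<forall>z\<in>Mvar. H (group_action g z) = H z) \<and>
     (\<forall>t. (\<forall>i. t i \<noteq> 0) \<longrightarrow>
        (\<forall>z\<in>Mvar. H (torus_action t z) = (\<Prod>i\<in>UNIV. t i) powi (-3) * H z))}"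


section \<open>Equivariant embeddings into the coordinate ring of one factor\<close>

definition equivariant_embedding ::
  "(complex \<Rightarrow> 'v \<Rightarrow> 'v) \<Rightarrow> 'v::ab_group_add set \<Rightarrow> (complex^3^3 \<Rightarrow> 'v \<Rightarrow> 'v) \<Rightarrow> ('v \<Rightarrow> vec_covec \<Rightarrow> complex) \<Rightarrow> bool"
where
  "equivariant_embedding sc V \<rho> \<phi> \<longleftrightarrow>
     linear_on sc fscale V \<phi> \<and> inj_on \<phi> V \<and>
     \<phi> ` V \<subseteq> coordinate_ring pair_coords incidence \<and>
     (\<forall>g\<in>SL3. \<forall>v\<in>V. \<forall>z\<in>incidence. \<phi> (\<rho> g v) z = \<phi> v (pair_action (matrix_inv g) z))"

end

theory Submission
  imports Defs "HOL-Computational_Algebra.Polynomial"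
begin

text \<open>Write \<open>K\<^sub>w(A, l) = (l \<cdot> x)\<^sup>a (y \<cdot> A)\<^sup>b\<close> for a flag \<open>w = (x, y)\<close>, i.e. \<open>y \<cdot> x = 0\<close>, and let \<open>w\<^sub>0 = (e\<^sub>1, e\<^sub>3)\<close>.
  If \<open>v\<close> is a highest weight vector of weight \<open>(a, b)\<close> in an irreducible \<open>V\<close>, then
  \<open>h v \<mapsto> K\<^bsub>h w\<^sub>0\<^esub>\<close> extends to a linear embedding of \<open>V\<close> into the functions on the incidence cone:
  for \<open>h = u b\<close> in the big cell, \<open>s\<^sup>-\<^sup>a\<^sup>-\<^sup>b \<eta>(\<lambda>(s) h v)\<close> with \<open>\<lambda>(s) = diag(s, 1, s\<^sup>-\<^sup>1)\<close> and \<open>\<eta>(v) = 1\<close> tends to the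
  value of \<open>K\<^bsub>h w\<^sub>0\<^esub>\<close> at \<open>(e\<^sub>3, e\<^sub>1)\<close> as \<open>s \<rightarrow> \<infinity>\<close>, so linear relations between the \<open>h v\<close> pass to the
  \<open>K\<^bsub>h w\<^sub>0\<^esub>\<close>, first generically and then everywhere because the cone is irreducible. Its image is the
  whole bihomogeneous component of bidegree \<open>(a, b)\<close>: a polynomial orthogonal to all \<open>K\<^sub>w\<close> vanishes on
  the (conjugation-stable) cone. Taking products over the \<open>n\<close> factors identifies the tensor products
  with the multihomogeneous components of the coordinate ring; being invariant under \<open>SL\<^sub>3\<close> and having
  torus weight \<open>-3\<close> can be tested on the components, and the torus condition selects the bidegrees
  \<open>(r\<^sub>i + 3, r\<^sub>i)\<close>.\<close>

section \<open>Polynomial functions and the incidence cone\<close>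

interpretation fun_space: vector_space "fscale :: complex \<Rightarrow> ('x \<Rightarrow> complex) \<Rightarrow> 'x \<Rightarrow> complex"
  by unfold_locales (auto simp: pointwise_def fun_eq_iff algebra_simps)

abbreviation fspan :: "('x \<Rightarrow> complex) set \<Rightarrow> ('x \<Rightarrow> complex) set" where
  "fspan \<equiv> module.span fscale"

lemma poly_funs_sum:
  "(\<And>i. i \<in> I \<Longrightarrow> f i \<in> poly_funs C) \<Longrightarrow> (\<lambda>x. \<Sum>i\<in>I. f i x) \<in> poly_funs C"
  by (induction I rule: infinite_finite_induct) (auto intro: poly_funs.intros)

lemma poly_funs_prod:
  "(\<And>i. i \<in> I \<Longrightarrow> f i \<in> poly_funs C) \<Longrightarrow> (\<lambda>x. \<Prod>i\<in>I. f i x) \<in> poly_funs C"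
  by (induction I rule: infinite_finite_induct) (auto intro: poly_funs.intros)

lemma poly_funs_power: "f \<in> poly_funs C \<Longrightarrow> (\<lambda>x. f x ^ n) \<in> poly_funs C"
  by (induction n) (auto intro: poly_funs.intros)

lemma poly_funs_diff:
  "f \<in> poly_funs C \<Longrightarrow> g \<in> poly_funs C \<Longrightarrow> (\<lambda>x. f x - g x) \<in> poly_funs C"
  using poly_funs.add[OF _ poly_funs.mult[OF poly_funs.const[of "-1"]]] by force

lemmas poly_funs_intros = poly_funs.const poly_funs.add poly_funs.mult
  poly_funs_sum poly_funs_prod poly_funs_power poly_funs_diff

lemma poly_funs_comp:
  assumes "p \<in> poly_funs C" and "\<And>f. f \<in> C \<Longrightarrow> (\<lambda>t. f (\<gamma> t)) \<in> poly_funs D"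
  shows "(\<lambda>t. p (\<gamma> t)) \<in> poly_funs D"
  using assms(1)
proof induction
  case (coord f)
  then show ?case by (rule assms(2))
qed (auto intro: poly_funs.intros)

text \<open>With the identity as only coordinate, the closure rules build values of library
  polynomials. This gives access to the fact that \<open>complex poly\<close> has no zero
  divisors.\<close>

lemma poly_funs_univariate:
  assumes "p \<in> poly_funs {\<lambda>t. t}"
  obtains P where "\<And>t. p t = poly P t"
proof -
  from assms have "\<exists>P. \<forall>t. p t = poly P t"
  proof induction
    case (const c)
    show ?case by (rule exI[of _ "[:c:]"]) simp
  next
    case (coord f)
    then show ?case by (intro exI[of _ "[:0, 1:]"]) simp
  next
    case (add f g)
    then show ?case by (metis poly_add)
  next
    case (mult f g)
    then show ?case by (metis poly_mult)
  qed
  then show thesis using that by blast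
qed

text \<open>Multiplied by the variable, the polynomial vanishes everywhere and hence is zero. This
  is the algebraic form of passing to the limit at 0.\<close>

lemma poly_eqI_nonzero:
  fixes P :: "complex poly"
  assumes "\<And>t. t \<noteq> 0 \<Longrightarrow> poly P t = 0"
  shows "poly P 0 = 0"
proof -
  have "poly ([:0,1:] * P) t = 0" for t
    using assms[of t] by (cases "t = 0") auto
  then have "[:0,1:] * P = 0"
    using poly_all_0_iff_0 by blast
  then show ?thesis by simp
qed

section \<open>The incidence cone and its irreducibility\<close>

lemma incidence_iff:
  "(A, l) \<in> incidence \<longleftrightarrow> l$1 * A$1 + l$2 * A$2 + l$3 * A$3 = 0"
  by (simp add: incidence_def sum_3)

text \<open>The polynomial map \<open>(\<alpha>, u, w) \<mapsto> (\<alpha> u, u \<times> w)\<close> from an affine space onto the incidence cone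
  shows that the latter is irreducible.\<close>

definition incidence_param :: "complex \<Rightarrow> complex^3 \<Rightarrow> complex^3 \<Rightarrow> vec_covec" where
  "incidence_param \<alpha> u w = (\<alpha> *s u,
     vector [u$2 * w$3 - u$3 * w$2, u$3 * w$1 - u$1 * w$3, u$1 * w$2 - u$2 * w$1])"

lemma incidence_param_in: "incidence_param \<alpha> u w \<in> incidence"
  by (simp add: incidence_param_def incidence_iff vector_3 algebra_simps)

text \<open>If a non-zero \<open>u\<close> is orthogonal to \<open>l\<close>, then \<open>l\<close>
  is a cross product \<open>u \<times> w\<close>. For \<open>A \<noteq> 0\<close> take
  \<open>u = A\<close> and scalar 1; for \<open>A = 0\<close> any non-zero \<open>u\<close>
  orthogonal to \<open>l\<close> works with scalar 0.\<close>

lemma incidence_param_surj: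
  assumes "z \<in> incidence"
  shows "\<exists>\<alpha> u w. z = incidence_param \<alpha> u w"
proof -
  obtain A l where z: "z = (A, l)" by force
  have cross: "\<exists>w :: complex^3. l = vector [u$2 * w$3 - u$3 * w$2, u$3 * w$1 - u$1 * w$3, u$1 * w$2 - u$2 * w$1]"
    if u: "u \<noteq> 0" and lu: "l$1 * u$1 + l$2 * u$2 + l$3 * u$3 = 0" for u :: "complex^3"
  proof -
    consider "u$1 \<noteq> 0" | "u$2 \<noteq> 0" | "u$3 \<noteq> 0"
      using u by (auto simp: vec_eq_iff forall_3)
    then show ?thesis
    proof cases
      case 1
      \<comment> \<open>The solution is unique up to multiples of \<open>u\<close>, so its
        coordinate at a place where \<open>u\<close> does not vanish can be normalised to 0.\<close>
      define w where "w = (vector [0, l$3 / u$1, - l$2 / u$1] :: complex^3)"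
      have "w$1 = 0" "w$2 = l$3 / u$1" "w$3 = - l$2 / u$1"
        by (simp_all add: w_def vector_3)
      with 1 lu show ?thesis
        by (intro exI[of _ w]) (simp add: vec_eq_iff forall_3 vector_3 field_simps, algebra)
    next
      case 2
      define w where "w = (vector [- l$3 / u$2, 0, l$1 / u$2] :: complex^3)"
      have "w$1 = - l$3 / u$2" "w$2 = 0" "w$3 = l$1 / u$2"
        by (simp_all add: w_def vector_3)
      with 2 lu show ?thesis
        by (intro exI[of _ w]) (simp add: vec_eq_iff forall_3 vector_3 field_simps, algebra)
    next
      case 3
      define w where "w = (vector [l$2 / u$3, - l$1 / u$3, 0] :: complex^3)"
      have "w$1 = l$2 / u$3" "w$2 = - l$1 / u$3" "w$3 = 0"
        by (simp_all add: w_def vector_3)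
      with 3 lu show ?thesis
        by (intro exI[of _ w]) (simp add: vec_eq_iff forall_3 vector_3 field_simps, algebra)
    qed
  qed
  show ?thesis
  proof (cases "A = 0")
    case False
    then obtain w where "(A, l) = incidence_param 1 A w"
      using cross[of A] assms z by (auto simp: incidence_iff incidence_param_def)
    then show ?thesis using z by blast
  next
    case True
    \<comment> \<open>The case distinction keeps \<open>u\<close> non-zero: the second vector is
      always orthogonal to \<open>l\<close> but may vanish.\<close>
    define u :: "complex^3" where
      "u = (if l$1 = 0 \<and> l$2 = 0 then vector [1, 0, 0] else vector [l$2, - l$1, 0])"
    have "u \<noteq> 0" "l$1 * u$1 + l$2 * u$2 + l$3 * u$3 = 0"
      by (auto simp: u_def vec_eq_iff forall_3 vector_3)
    then obtain w where "(A, l) = incidence_param 0 u w"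
      using cross[of u] True by (auto simp: incidence_param_def)
    then show ?thesis using z by blast
  qed
qed

text \<open>Two points of the cone lie on a polynomial curve inside it. Along this curve
  \<open>p\<close> and \<open>q\<close> become polynomials in one variable with product zero, and
  the one from \<open>q\<close> is not zero.\<close>

lemma incidence_irreducible:
  assumes p: "p \<in> poly_funs pair_coords" and q: "q \<in> poly_funs pair_coords"
    and pq: "\<And>z. z \<in> incidence \<Longrightarrow> p z * q z = 0"
    and z1: "z1 \<in> incidence" "q z1 \<noteq> 0" and z2: "z2 \<in> incidence"
  shows "p z2 = 0"
proof (rule ccontr)
  assume pz2: "p z2 \<noteq> 0"
  obtain a1 u1 w1 where 1: "z1 = incidence_param a1 u1 w1"
    using incidence_param_surj[OF z1(1)] by blast
  obtain a2 u2 w2 where 2: "z2 = incidence_param a2 u2 w2"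
    using incidence_param_surj[OF z2] by blast
  \<comment> \<open>The segment is drawn in the parameter space, because the cone is not convex; its
    image stays in the cone.\<close>
  define \<gamma> where "\<gamma> = (\<lambda>t. incidence_param (a1 + t * (a2 - a1)) (u1 + t *s (u2 - u1)) (w1 + t *s (w2 - w1)))"
  have \<gamma>01: "\<gamma> 0 = z1" "\<gamma> 1 = z2"
    by (simp_all add: \<gamma>_def 1 2)
  have id: "(\<lambda>t. t) \<in> poly_funs {\<lambda>t. t}"
    by (rule poly_funs.coord) simp
  have coords: "(\<lambda>t. f (\<gamma> t)) \<in> poly_funs {\<lambda>t. t}" if "f \<in> pair_coords" for f
  proof -
    have "(\<lambda>t. fst (\<gamma> t) $ k) \<in> poly_funs {\<lambda>t. t}" for k
      unfolding \<gamma>_def incidence_param_def fst_conv vector_smult_component vector_add_component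
      by (intro poly_funs_intros id)
    moreover have "(\<lambda>t. snd (\<gamma> t) $ k) \<in> poly_funs {\<lambda>t. t}" for k
      using exhaust_3[of k]
      unfolding \<gamma>_def incidence_param_def snd_conv vector_smult_component vector_add_component
      by (elim disjE) (simp_all only: vector_3, (intro poly_funs_intros id)+)
    ultimately show ?thesis
      using that by (auto simp: pair_coords_def)
  qed
  obtain P where P: "\<And>t. p (\<gamma> t) = poly P t"
    using poly_funs_univariate[OF poly_funs_comp[where \<gamma> = \<gamma>, OF p coords]] by blast
  obtain Q where Q: "\<And>t. q (\<gamma> t) = poly Q t"
    using poly_funs_univariate[OF poly_funs_comp[where \<gamma> = \<gamma>, OF q coords]] by blast
  have "P \<noteq> 0" using P[of 1] pz2 \<gamma>01 by auto
  moreover have "Q \<noteq> 0" using Q[of 0] z1 \<gamma>01 by auto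
  moreover have "poly (P * Q) t = 0" for t
    using pq[of "\<gamma> t"] P Q by (simp add: \<gamma>_def incidence_param_in)
  ultimately show False
    using poly_all_0_iff_0[of "P * Q"] by auto
qed

section \<open>The group action and flag kernels\<close>

definition bil :: "complex^3 \<Rightarrow> complex^3 \<Rightarrow> complex" where
  "bil l A = (\<Sum>k\<in>UNIV. l $ k * A $ k)"

lemma bil_3: "bil l A = l$1 * A$1 + l$2 * A$2 + l$3 * A$3"
  by (simp add: bil_def sum_3)

lemma incidence_bil: "z \<in> incidence \<longleftrightarrow> bil (snd z) (fst z) = 0"
  by (auto simp: incidence_def bil_def)

lemma bil_matrix: "bil (l v* h) A = bil l (h *v A)"
  by (simp add: bil_3 vector_matrix_mult_def matrix_vector_mult_def sum_3 algebra_simps)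

section \<open>Inverses in SL3 and its action on pairs\<close>

lemma matrix_inv_unique:
  fixes g h :: "complex^3^3"
  assumes "g ** h = mat 1"
  shows "matrix_inv g = h"
proof -
  have "h ** g = mat 1" using assms by (simp add: matrix_left_right_inverse)
  then have ex: "\<exists>A'. g ** A' = mat 1 \<and> A' ** g = mat 1" using assms by blast
  have "matrix_inv g ** g = mat 1"
    unfolding matrix_inv_def using someI_ex[OF ex] by blast
  then have "matrix_inv g = matrix_inv g ** (g ** h)" by (simp add: assms)
  also have "\<dots> = h" by (simp add: matrix_mul_assoc \<open>matrix_inv g ** g = mat 1\<close>)
  finally show ?thesis .
qed

lemma SL3_inv_right: "g \<in> SL3 \<Longrightarrow> g ** matrix_inv g = mat 1"
  and SL3_inv_left: "g \<in> SL3 \<Longrightarrow> matrix_inv g ** g = mat 1"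
proof -
  assume "g \<in> SL3"
  then have "invertible g" by (simp add: SL3_def invertible_det_nz)
  then obtain h where h: "g ** h = mat 1" "h ** g = mat 1" unfolding invertible_def by blast
  then show "g ** matrix_inv g = mat 1" "matrix_inv g ** g = mat 1"
    using matrix_inv_unique by auto
qed

lemma SL3_mult: "g \<in> SL3 \<Longrightarrow> h \<in> SL3 \<Longrightarrow> g ** h \<in> SL3"
  by (simp add: SL3_def det_mul)

lemma SL3_one: "mat 1 \<in> SL3"
  by (simp add: SL3_def)

lemma SL3_inv: "g \<in> SL3 \<Longrightarrow> matrix_inv g \<in> SL3"
  using SL3_inv_right[of g] det_mul[of g "matrix_inv g"] by (simp add: SL3_def)

lemma SL3_inv_inv: "g \<in> SL3 \<Longrightarrow> matrix_inv (matrix_inv g) = g"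
  by (rule matrix_inv_unique) (rule SL3_inv_left)

lemma SL3_inv_mult:
  assumes "g \<in> SL3" "h \<in> SL3"
  shows "matrix_inv (g ** h) = matrix_inv h ** matrix_inv g"
proof (rule matrix_inv_unique)
  have "g ** h ** (matrix_inv h ** matrix_inv g) = g ** (h ** matrix_inv h) ** matrix_inv g"
    by (simp only: matrix_mul_assoc)
  then show "g ** h ** (matrix_inv h ** matrix_inv g) = mat 1"
    by (simp add: SL3_inv_right assms)
qed

lemma pair_action_one: "pair_action (mat 1) z = z"
  using matrix_inv_unique[of "mat 1" "mat 1"] by (simp add: pair_action_def)

lemma pair_action_mult:
  "g \<in> SL3 \<Longrightarrow> h \<in> SL3 \<Longrightarrow> pair_action (g ** h) z = pair_action g (pair_action h z)"
  by (simp add: pair_action_def SL3_inv_mult matrix_vector_mul_assoc vector_matrix_mul_assoc)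

lemma pair_action_inv_cancel:
  "g \<in> SL3 \<Longrightarrow> pair_action g (pair_action (matrix_inv g) z) = z"
  "g \<in> SL3 \<Longrightarrow> pair_action (matrix_inv g) (pair_action g z) = z"
  by (simp_all flip: pair_action_mult add: SL3_inv SL3_inv_left SL3_inv_right pair_action_one)

lemma bil_pair_action:
  "g \<in> SL3 \<Longrightarrow> bil (snd (pair_action g z)) (fst (pair_action g w)) = bil (snd z) (fst w)"
  by (simp add: pair_action_def bil_matrix matrix_vector_mul_assoc SL3_inv_left)

lemma pair_action_incidence: "g \<in> SL3 \<Longrightarrow> pair_action g z \<in> incidence \<longleftrightarrow> z \<in> incidence"
  by (simp add: incidence_bil bil_pair_action)

section \<open>Flag kernels and transitivity on non-degenerate flags\<close>

definition flag_kernel :: "nat \<Rightarrow> nat \<Rightarrow> vec_covec \<Rightarrow> vec_covec \<Rightarrow> complex" where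
  "flag_kernel a b w z =
     (if z \<in> incidence then bil (snd z) (fst w) ^ a * bil (snd w) (fst z) ^ b else 0)"

text \<open>An upper triangular \<open>g\<close> in SL3 scales the two entries by
  \<open>g$1$1\<close> and by \<open>1 / g$3$3\<close>, which equals \<open>g$1$1 * g$2$2\<close>.
  So the kernel of this flag has the weight of a highest weight vector.\<close>

definition base_flag :: vec_covec where
  "base_flag = (axis 1 1, axis 3 1)"

text \<open>The flag preserved up to scalars by the lower triangular matrices.\<close>

definition opposite_flag :: vec_covec where
  "opposite_flag = (axis 3 1, axis 1 1)"

lemma flag_kernel_invariant:
  "g \<in> SL3 \<Longrightarrow> flag_kernel a b (pair_action g w) (pair_action g z) = flag_kernel a b w z"
  by (simp add: flag_kernel_def bil_pair_action pair_action_incidence)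

lemma flag_kernel_move:
  "g \<in> SL3 \<Longrightarrow> flag_kernel a b w (pair_action g z) = flag_kernel a b (pair_action (matrix_inv g) w) z"
  using flag_kernel_invariant[of "matrix_inv g" a b w "pair_action g z"]
  by (simp add: SL3_inv pair_action_inv_cancel)

lemma pair_coords_poly:
  "(\<lambda>z. fst z $ k) \<in> poly_funs pair_coords" "(\<lambda>z. snd z $ k) \<in> poly_funs pair_coords"
  by (auto intro!: poly_funs.coord simp: pair_coords_def)

lemma flag_kernel_poly:
  "(\<lambda>z. bil (snd z) (fst w) ^ a * bil (snd w) (fst z) ^ b) \<in> poly_funs pair_coords"
  unfolding bil_def by (intro poly_funs_intros pair_coords_poly)

text \<open>The value 0 off the cone in \<open>flag_kernel\<close> follows the convention of
  \<open>coordinate_ring\<close>, so that the kernels are literally elements of it.\<close>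

lemma flag_kernel_coordinate_ring:
  "flag_kernel a b w \<in> coordinate_ring pair_coords incidence"
  using flag_kernel_poly[of w a b] unfolding coordinate_ring_def flag_kernel_def
  by (auto intro!: bexI)

lemma base_flag_incidence: "base_flag \<in> incidence" "opposite_flag \<in> incidence"
  by (simp_all add: base_flag_def opposite_flag_def incidence_iff axis_def)

lemma flag_kernel_base_opposite: "flag_kernel a b base_flag opposite_flag = 1"
  using base_flag_incidence by (simp add: flag_kernel_def) (simp add: base_flag_def opposite_flag_def bil_3 axis_def)

text \<open>The matrix is assembled from columns \<open>A\<close>, \<open>d\<close>,
  \<open>c\<close> of determinant 1 on which \<open>l\<close> takes the values 0, 0, 1. These values
  say that \<open>l v* h\<close> is the third coordinate covector.\<close>

lemma SL3_transitive:
  assumes "(A, l) \<in> incidence" "A \<noteq> 0" "l \<noteq> 0"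
  obtains h where "h \<in> SL3" "pair_action h base_flag = (A, l)"
proof -
  have dual: "\<exists>x. bil u x = 1" if "u \<noteq> 0" for u
  proof -
    from that obtain k where "u $ k \<noteq> 0" by (auto simp: vec_eq_iff)
    then have "bil u (axis k (1 / u $ k)) = 1"
      by (simp add: bil_def axis_def if_distrib cong: if_cong)
    then show ?thesis by blast
  qed
  have lin: "bil u (x - c *s y) = bil u x - c * bil u y" for u x y c
    by (simp add: bil_3 algebra_simps)
  obtain c where c: "bil l c = 1" using dual assms by blast
  \<comment> \<open>The cross product of \<open>c\<close> and \<open>A\<close>: its pairing with
    \<open>d\<close> is the determinant of the matrix with columns \<open>A\<close>,
    \<open>d\<close>, \<open>c\<close>.\<close>
  define n :: "complex^3" where
    "n = vector [c$2 * A$3 - c$3 * A$2, c$3 * A$1 - c$1 * A$3, c$1 * A$2 - c$2 * A$1]"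
  have lA: "bil l A = 0" using assms by (simp add: incidence_bil)
  \<comment> \<open>Otherwise \<open>c\<close> and the non-zero \<open>A\<close> would be parallel,
    although \<open>l\<close> is 1 on \<open>c\<close> and 0 on \<open>A\<close>.\<close>
  have n0: "n \<noteq> 0"
  proof
    assume "n = 0"
    then have "c$2 * A$3 - c$3 * A$2 = 0" "c$3 * A$1 - c$1 * A$3 = 0" "c$1 * A$2 - c$2 * A$1 = 0"
      by (auto simp: n_def vec_eq_iff forall_3 vector_3)
    with c lA have "A$1 = 0" "A$2 = 0" "A$3 = 0"
      unfolding bil_3 by algebra+
    with assms(2) show False by (simp add: vec_eq_iff forall_3)
  qed
  then obtain d0 where d0: "bil n d0 = 1" using dual by blast
  \<comment> \<open>Subtracting a multiple of \<open>c\<close> makes \<open>l\<close> vanish on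
    \<open>d\<close> and keeps the determinant, since \<open>n\<close> vanishes on
    \<open>c\<close>.\<close>
  define d where "d = d0 - bil l d0 *s c"
  have "bil n c = 0" by (simp add: n_def bil_3 vector_3 algebra_simps)
  then have d: "bil n d = 1" "bil l d = 0"
    using c d0 by (simp_all add: d_def lin)
  define h :: "complex^3^3" where
    "h = vector [vector [A$1, d$1, c$1], vector [A$2, d$2, c$2], vector [A$3, d$3, c$3]]"
  have "det h = bil n d"
    by (simp add: det_3 h_def vector_3 n_def bil_3 algebra_simps)
  then have h: "h \<in> SL3" using d by (simp add: SL3_def)
  have "l v* h = axis 3 1"
    using lA d c
    by (simp add: vec_eq_iff forall_3 vector_matrix_mult_def sum_3 h_def vector_3 axis_def bil_3 algebra_simps)
  then have "axis 3 1 v* matrix_inv h = (l v* h) v* matrix_inv h" by simp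
  also have "\<dots> = l" by (simp add: vector_matrix_mul_assoc SL3_inv_right h)
  finally have "axis 3 1 v* matrix_inv h = l" .
  moreover have "h *v axis 1 1 = A"
    by (simp add: vec_eq_iff forall_3 matrix_vector_mult_def sum_3 h_def vector_3 axis_def)
  ultimately have "pair_action h base_flag = (A, l)"
    by (simp add: pair_action_def base_flag_def)
  then show thesis using that h by blast
qed

lemma opposite_flag_orbit:
  assumes "z \<in> incidence" "fst z \<noteq> 0" "snd z \<noteq> 0"
  obtains g where "g \<in> SL3" "z = pair_action g opposite_flag"
proof -
  obtain h where h: "h \<in> SL3" "pair_action h base_flag = z"
    using SL3_transitive[of "fst z" "snd z"] assms by auto
  have "axis 3 1 \<noteq> (0 :: complex^3)" "axis 1 1 \<noteq> (0 :: complex^3)"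
    by (simp_all add: axis_eq_0_iff)
  then obtain s where s: "s \<in> SL3" "pair_action s base_flag = opposite_flag"
    using SL3_transitive[of "axis 3 1" "axis 1 1"] base_flag_incidence by (auto simp: opposite_flag_def)
  have "base_flag = pair_action (matrix_inv s) opposite_flag"
    using s pair_action_inv_cancel(2)[of s base_flag] by simp
  then have "z = pair_action (h ** matrix_inv s) opposite_flag"
    using h s by (simp add: pair_action_mult SL3_inv)
  then show thesis using that h s SL3_mult SL3_inv by blast
qed

text \<open>The degenerate pairs lie in the zero set of \<open>l$1 * A$3\<close>, which is 1 at the
  opposite flag, so irreducibility extends the vanishing of \<open>p\<close> across them.\<close>

lemma incidence_density:
  assumes p: "p \<in> poly_funs pair_coords"
    and "\<And>z. z \<in> incidence \<Longrightarrow> fst z \<noteq> 0 \<Longrightarrow> snd z \<noteq> 0 \<Longrightarrow> p z = 0"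
    and "z \<in> incidence"
  shows "p z = 0"
proof (rule incidence_irreducible[OF p flag_kernel_poly[of base_flag 1 1]])
  show "opposite_flag \<in> incidence" "z \<in> incidence" using base_flag_incidence assms by auto
  show "p z * (bil (snd z) (fst base_flag) ^ 1 * bil (snd base_flag) (fst z) ^ 1) = 0"
    if "z \<in> incidence" for z
    using assms(2)[OF that] by (cases "fst z = 0"; cases "snd z = 0") (simp_all add: bil_def)
  show "bil (snd opposite_flag) (fst base_flag) ^ 1 * bil (snd base_flag) (fst opposite_flag) ^ 1 \<noteq> 0"
    by (simp add: base_flag_def opposite_flag_def bil_3 axis_def)
qed

section \<open>Lower unipotent matrices, the torus and the big cell\<close>

definition lower_unipotent :: "complex \<Rightarrow> complex \<Rightarrow> complex \<Rightarrow> complex^3^3" where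
  "lower_unipotent x y w = vector [vector [1, 0, 0], vector [x, 1, 0], vector [y, w, 1]]"

text \<open>The one-parameter subgroup \<open>diag(s, 1, 1/s)\<close> at
  \<open>s = 1/\<epsilon>\<close>, so that the limit at infinity becomes evaluation at
  \<open>\<epsilon> = 0\<close>.\<close>

definition torus_element :: "complex \<Rightarrow> complex^3^3" where
  "torus_element \<epsilon> = vector [vector [1 / \<epsilon>, 0, 0], vector [0, 1, 0], vector [0, 0, \<epsilon>]]"

lemma lower_unipotent_SL3: "lower_unipotent x y w \<in> SL3"
  by (simp add: SL3_def det_3 lower_unipotent_def vector_3)

lemma torus_element_SL3: "\<epsilon> \<noteq> 0 \<Longrightarrow> torus_element \<epsilon> \<in> SL3"
  by (simp add: SL3_def det_3 torus_element_def vector_3)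

text \<open>An instance of Cramer's rule. This entry is the value of the covector of
  \<open>pair_action h base_flag\<close> at the vector of the opposite flag.\<close>

lemma SL3_inv_33:
  assumes "h \<in> SL3"
  shows "matrix_inv h $ 3 $ 3 = h$1$1 * h$2$2 - h$1$2 * h$2$1"
proof -
  define r where "r = matrix_inv h $ 3"
  have "(matrix_inv h ** h) $ 3 $ j = (mat 1 :: complex^3^3) $ 3 $ j" for j
    using SL3_inv_left[OF assms] by simp
  from this[of 1] this[of 2] this[of 3]
  have "r$1 * h$1$1 + r$2 * h$2$1 + r$3 * h$3$1 = 0"
    "r$1 * h$1$2 + r$2 * h$2$2 + r$3 * h$3$2 = 0"
    "r$1 * h$1$3 + r$2 * h$2$3 + r$3 * h$3$3 = 1"
    by (simp_all add: r_def matrix_matrix_mult_def sum_3 mat_def)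
  moreover have "h$1$1 * h$2$2 * h$3$3 + h$1$2 * h$2$3 * h$3$1 + h$1$3 * h$2$1 * h$3$2
    - h$1$1 * h$2$3 * h$3$2 - h$1$2 * h$2$1 * h$3$3 - h$1$3 * h$2$2 * h$3$1 = 1"
    using assms by (simp add: SL3_def det_3)
  ultimately show ?thesis unfolding r_def[symmetric] by algebra
qed

text \<open>Both factors are leading principal minors of \<open>h\<close>, and \<open>h\<close> lies
  in the big cell when neither vanishes.\<close>

lemma flag_kernel_translate_opposite:
  assumes "h \<in> SL3"
  shows "flag_kernel a b (pair_action h base_flag) opposite_flag
    = h$1$1 ^ a * (h$1$1 * h$2$2 - h$1$2 * h$2$1) ^ b"
  using base_flag_incidence SL3_inv_33[OF assms]
  by (simp add: flag_kernel_def) (simp add: opposite_flag_def base_flag_def pair_action_def bil_3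
    matrix_vector_mult_def vector_matrix_mult_def sum_3 axis_def)

text \<open>Conjugation by the torus element contracts the lower unipotent factor of the big cell to the
  identity as \<open>\<epsilon> \<rightarrow> 0\<close>.\<close>

lemma big_cell:
  assumes h: "h \<in> SL3" and "h$1$1 \<noteq> 0" "h$1$1 * h$2$2 - h$1$2 * h$2$1 \<noteq> 0"
  obtains x y w where
    "\<And>\<epsilon>. \<epsilon> \<noteq> 0 \<Longrightarrow> \<exists>b\<in>borel_subgroup.
       torus_element \<epsilon> ** h = lower_unipotent (\<epsilon> * x) (\<epsilon>\<^sup>2 * y) (\<epsilon> * w) ** b \<and>
       b$1$1 = h$1$1 / \<epsilon> \<and> b$1$1 * b$2$2 = (h$1$1 * h$2$2 - h$1$2 * h$2$1) / \<epsilon>"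
proof -
  \<comment> \<open>Gaussian elimination without pivoting: \<open>x\<close>, \<open>y\<close>,
    \<open>w\<close> are the entries below the diagonal of the lower unipotent factor of
    \<open>h\<close>.\<close>
  define x where "x = h$2$1 / h$1$1"
  define y where "y = h$3$1 / h$1$1"
  define w where "w = (h$3$2 - y * h$1$2) / (h$2$2 - x * h$1$2)"
  have m: "h$1$1 * (h$2$2 - x * h$1$2) = h$1$1 * h$2$2 - h$1$2 * h$2$1"
    using assms by (simp add: x_def field_simps)
  have x: "h$2$1 - x * h$1$1 = 0" and y: "h$3$1 - y * h$1$1 = 0"
    using assms by (simp_all add: x_def y_def)
  have nz: "h$2$2 - x * h$1$2 \<noteq> 0" using m assms by auto
  then have w: "h$3$2 - y * h$1$2 - w * (h$2$2 - x * h$1$2) = 0"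
    by (simp add: w_def)
  show thesis
  proof (rule that[of x y w])
    fix \<epsilon> :: complex assume e: "\<epsilon> \<noteq> 0"
    \<comment> \<open>The torus element times the upper triangular factor of \<open>h\<close>.
      Moving the torus element past the lower factor produces the powers of
      \<open>\<epsilon>\<close> there.\<close>
    define b :: "complex^3^3" where
      "b = (\<chi> i j. if i = 1 then h$1$j / \<epsilon> else if i = 2 then h$2$j - x * h$1$j
         else \<epsilon> * (h$3$j - y * h$1$j - w * (h$2$j - x * h$1$j)))"
    have eq: "torus_element \<epsilon> ** h = lower_unipotent (\<epsilon> * x) (\<epsilon>\<^sup>2 * y) (\<epsilon> * w) ** b"
      using e by (simp add: vec_eq_iff forall_3 matrix_matrix_mult_def sum_3 torus_element_def
        lower_unipotent_def vector_3 b_def field_simps power2_eq_square)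
    have "det (torus_element \<epsilon> ** h) = det b"
      using lower_unipotent_SL3 unfolding eq by (simp add: det_mul SL3_def)
    then have "det b = 1" using torus_element_SL3[OF e] h by (simp add: det_mul SL3_def)
    moreover have "b$2$1 = 0" "b$3$1 = 0" "b$3$2 = 0"
      using x y w by (simp_all add: b_def)
    ultimately have "b \<in> borel_subgroup" by (simp add: borel_subgroup_def SL3_def)
    moreover have "b$1$1 = h$1$1 / \<epsilon>" "b$1$1 * b$2$2 = (h$1$1 * h$2$2 - h$1$2 * h$2$1) / \<epsilon>"
      using m by (simp_all add: b_def)
    ultimately show "\<exists>b\<in>borel_subgroup.
       torus_element \<epsilon> ** h = lower_unipotent (\<epsilon> * x) (\<epsilon>\<^sup>2 * y) (\<epsilon> * w) ** b \<and>
       b$1$1 = h$1$1 / \<epsilon> \<and> b$1$1 * b$2$2 = (h$1$1 * h$2$2 - h$1$2 * h$2$1) / \<epsilon>"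
      using eq by blast
  qed
qed

section \<open>Embedding an irreducible representation\<close>

lemma sum_fun_apply: "(\<Sum>i\<in>I. f i) x = (\<Sum>i\<in>I. f i x)"
  by (induction I rule: infinite_finite_induct) auto

lemma coordinate_ring_subspace: "module.subspace fscale (coordinate_ring C M)"
proof (rule fun_space.subspaceI)
  show "0 \<in> coordinate_ring C M"
    by (auto simp: coordinate_ring_def intro!: bexI[OF _ poly_funs.const[of 0]])
next
  fix f g assume "f \<in> coordinate_ring C M" "g \<in> coordinate_ring C M"
  then obtain p q where "p \<in> poly_funs C" "\<forall>z\<in>M. f z = p z" "\<forall>z. z \<notin> M \<longrightarrow> f z = 0"
    "q \<in> poly_funs C" "\<forall>z\<in>M. g z = q z" "\<forall>z. z \<notin> M \<longrightarrow> g z = 0"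
    unfolding coordinate_ring_def by blast
  then show "f + g \<in> coordinate_ring C M"
    by (auto simp: coordinate_ring_def intro!: bexI[OF _ poly_funs.add])
next
  fix c f assume "f \<in> coordinate_ring C M"
  then obtain p where "p \<in> poly_funs C" "\<forall>z\<in>M. f z = p z" "\<forall>z. z \<notin> M \<longrightarrow> f z = 0"
    unfolding coordinate_ring_def by blast
  then show "fscale c f \<in> coordinate_ring C M"
    by (auto simp: coordinate_ring_def pointwise_def
      intro!: bexI[OF _ poly_funs.mult[OF poly_funs.const[of c]]])
qed

lemma linear_on_compose_sum:
  assumes "vector_space sc" "linear_on sc s2 V f" "module.subspace sc V" "vector_space s2"
    and "\<And>i. i \<in> I \<Longrightarrow> w i \<in> V"
  shows "f (\<Sum>i\<in>I. sc (c i) (w i)) = (\<Sum>i\<in>I. s2 (c i) (f (w i)))"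
proof -
  interpret vector_space sc by fact
  interpret s2: vector_space s2 by fact
  have "f 0 = 0"
    using assms(2) subspace_0[OF assms(3)] unfolding linear_on_def
    by (metis scale_zero_left s2.scale_zero_left)
  with assms(5) show ?thesis
  proof (induction I rule: infinite_finite_induct)
    case (insert i I)
    then have "(\<Sum>i\<in>I. sc (c i) (w i)) \<in> V" "sc (c i) (w i) \<in> V"
      using assms(3) by (auto intro!: subspace_sum subspace_scale)
    with insert assms(2) show ?case by (simp add: linear_on_def)
  qed auto
qed

text \<open>Irreducibility removes the factors one at a time. Thus finitely many non-trivial open
  conditions can be imposed on a point at once.\<close>

lemma incidence_irreducible_prod:
  assumes "finite I" "p \<in> poly_funs pair_coords"
    and "\<And>i. i \<in> I \<Longrightarrow> q i \<in> poly_funs pair_coords"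
    and "\<And>i. i \<in> I \<Longrightarrow> \<exists>z\<in>incidence. q i z \<noteq> 0"
    and "\<And>z. z \<in> incidence \<Longrightarrow> p z * (\<Prod>i\<in>I. q i z) = 0"
    and "z \<in> incidence"
  shows "p z = 0"
  using assms
proof (induction I arbitrary: z)
  case (insert i I)
  show ?case
  proof (rule insert.IH)
    fix y assume y: "y \<in> incidence"
    obtain z1 where z1: "z1 \<in> incidence" "q i z1 \<noteq> 0" using insert.prems(3) by blast
    show "p y * (\<Prod>i\<in>I. q i y) = 0"
    proof (rule incidence_irreducible[where p = "\<lambda>y. p y * (\<Prod>i\<in>I. q i y)" and q = "q i", OF _ _ _ z1 y])
      show "(\<lambda>y. p y * (\<Prod>i\<in>I. q i y)) \<in> poly_funs pair_coords"
        using insert.prems(1,2) by (intro poly_funs.mult poly_funs_prod) simp_all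
      show "q i \<in> poly_funs pair_coords" using insert.prems(2) by simp
      show "p y * (\<Prod>i\<in>I. q i y) * q i y = 0" if "y \<in> incidence" for y
        using insert.prems(4)[OF that] insert.hyps by (simp add: mult_ac)
    qed
  qed (use insert.prems in \<open>simp_all\<close>)
qed simp_all

section \<open>Irreducible representations with a fixed highest weight vector\<close>

locale highest_weight_irrep = vector_space sc
  for sc :: "complex \<Rightarrow> 'v::ab_group_add \<Rightarrow> 'v" +
  fixes V :: "'v set" and \<rho> :: "complex^3^3 \<Rightarrow> 'v \<Rightarrow> 'v" and a b :: nat and v :: 'v
  assumes irreducible: "irreducible_representation sc V \<rho>"
    and v_in: "v \<in> V" and v_nonzero: "v \<noteq> 0"
    and weight: "\<And>g. g \<in> borel_subgroup \<Longrightarrow> \<rho> g v = sc ((g $ 1 $ 1) ^ a * (g $ 1 $ 1 * g $ 2 $ 2) ^ b) v"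
begin

lemma rep: "SL3_representation sc V \<rho>"
  using irreducible by (simp add: irreducible_representation_def)

lemma V_subspace: "subspace V"
  using rep unfolding SL3_representation_def by (rule conjunct1)

lemma
  assumes "g \<in> SL3"
  shows \<rho>_linear: "linear_on sc sc V (\<rho> g)"
    and \<rho>_in: "w \<in> V \<Longrightarrow> \<rho> g w \<in> V"
proof -
  have *: "\<forall>g\<in>SL3. linear_on sc sc V (\<rho> g) \<and> \<rho> g ` V \<subseteq> V"
    using rep unfolding SL3_representation_def by (elim conjE)
  show "linear_on sc sc V (\<rho> g)" using * assms by blast
  show "w \<in> V \<Longrightarrow> \<rho> g w \<in> V" using * assms by blast
qed

lemma \<rho>_one:
  assumes "w \<in> V"
  shows "\<rho> (mat 1) w = w"
proof -
  have "\<forall>w\<in>V. \<rho> (mat 1) w = w"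
    using rep unfolding SL3_representation_def by (elim conjE)
  with assms show ?thesis by blast
qed

lemma \<rho>_mult:
  assumes "g \<in> SL3" "h \<in> SL3" "w \<in> V"
  shows "\<rho> (g ** h) w = \<rho> g (\<rho> h w)"
proof -
  have "\<forall>g\<in>SL3. \<forall>h\<in>SL3. \<forall>v\<in>V. \<rho> (g ** h) v = \<rho> g (\<rho> h v)"
    using rep unfolding SL3_representation_def by (elim conjE)
  with assms show ?thesis by blast
qed

lemma matrix_coefficient:
  assumes "linear_on sc (*) V \<xi>" "w \<in> V"
  shows "\<exists>p\<in>poly_funs {\<lambda>g. g $ i $ j | i j. True}. \<forall>g\<in>SL3. \<xi> (\<rho> g w) = p g"
proof -
  have "\<forall>\<xi>. linear_on sc (*) V \<xi> \<longrightarrow>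
    (\<forall>v\<in>V. \<exists>p\<in>poly_funs {\<lambda>g. g $ i $ j | i j. True}. \<forall>g\<in>SL3. \<xi> (\<rho> g v) = p g)"
    using rep unfolding SL3_representation_def by (elim conjE)
  with assms show ?thesis by blast
qed

lemma \<rho>_zero: "g \<in> SL3 \<Longrightarrow> \<rho> g 0 = 0"
  using \<rho>_linear[of g] subspace_0[OF V_subspace] unfolding linear_on_def
  by (metis scale_zero_left)

abbreviation "orbit \<equiv> {\<rho> h v | h. h \<in> SL3}"

text \<open>The span is stable under the group and contains the non-zero \<open>v\<close>, so
  irreducibility leaves only \<open>V\<close>.\<close>

lemma V_eq_span_orbit: "V = span orbit"
proof -
  have sub: "span orbit \<subseteq> V"
    using \<rho>_in v_in by (intro span_minimal V_subspace) auto
  have "\<rho> g w \<in> span orbit" if g: "g \<in> SL3" and w: "w \<in> span orbit" for g w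
  proof -
    from w have "w \<in> V \<and> \<rho> g w \<in> span orbit"
    proof (induction rule: span_induct_alt)
      case base
      then show ?case using \<rho>_zero[OF g] span_zero subspace_0[OF V_subspace] by simp
    next
      case (step c x y)
      then obtain h where h: "h \<in> SL3" "x = \<rho> h v" by blast
      then have xV: "x \<in> V" "sc c x \<in> V" using \<rho>_in v_in subspace_scale[OF V_subspace] by auto
      have "\<rho> g x = \<rho> (g ** h) v" using \<rho>_mult g h v_in by simp
      then have "\<rho> g x \<in> span orbit" using SL3_mult g h by (auto intro!: span_base)
      moreover have "\<rho> g (sc c x + y) = sc c (\<rho> g x) + \<rho> g y"
        using \<rho>_linear[OF g] xV step unfolding linear_on_def by metis
      ultimately show ?case
        using step xV subspace_add[OF V_subspace] by (simp add: span_add span_scale)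
    qed
    then show ?thesis by blast
  qed
  moreover have "v \<in> span orbit"
    using \<rho>_one[OF v_in] SL3_one by (intro span_base) force
  ultimately show ?thesis
    using irreducible sub v_nonzero unfolding irreducible_representation_def
    by (metis (no_types, lifting) image_subsetI singletonD subspace_span)
qed

lemma functional_at_v: obtains \<eta> where "linear_on sc (*) V \<eta>" "\<eta> v = 1"
proof -
  interpret vector_space_pair sc "(*) :: complex \<Rightarrow> complex \<Rightarrow> complex"
    by unfold_locales (auto simp: algebra_simps)
  obtain \<eta> where "Vector_Spaces.linear sc (*) \<eta>" "\<forall>x\<in>{v}. \<eta> x = 1"
    using linear_independent_extend[of "{v}" "\<lambda>_. 1"] v_nonzero by (auto simp: dependent_single)
  then show thesis
    using that[of \<eta>] by (auto simp: linear_on_def linear_add linear_scale)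
qed

text \<open>Applying the torus element and then \<open>\<eta>\<close> to the relation gives terms
  with the common denominator \<open>\<epsilon> ^ (a + b)\<close>. Once it is cleared, a polynomial
  remains that vanishes away from 0, and its value at 0 is the claimed sum.\<close>

lemma relation_at_opposite_flag:
  assumes "finite I" and h: "\<And>i. i \<in> I \<Longrightarrow> h i \<in> SL3"
    and rel: "(\<Sum>i\<in>I. sc (c i) (\<rho> (h i) v)) = 0"
    and nz: "\<And>i. i \<in> I \<Longrightarrow> h i $1$1 \<noteq> 0"
      "\<And>i. i \<in> I \<Longrightarrow> h i $1$1 * h i $2$2 - h i $1$2 * h i $2$1 \<noteq> 0"
  shows "(\<Sum>i\<in>I. c i * flag_kernel a b (pair_action (h i) base_flag) opposite_flag) = 0"
proof -
  define m where "m = (\<lambda>i. h i $1$1 * h i $2$2 - h i $1$2 * h i $2$1)"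
  obtain \<eta> where \<eta>: "linear_on sc (*) V \<eta>" "\<eta> v = 1" by (rule functional_at_v)
  obtain p where p: "p \<in> poly_funs {\<lambda>g :: complex^3^3. g $ i $ j | i j. True}"
    "\<And>g. g \<in> SL3 \<Longrightarrow> \<eta> (\<rho> g v) = p g"
    using matrix_coefficient[OF \<eta>(1) v_in] by blast
  \<comment> \<open>\<open>P\<close> is the matrix coefficient of the contracted lower unipotent
    factor, which is the identity at \<open>\<epsilon> = 0\<close>, where
    \<open>\<eta> v = 1\<close>. The Borel factor contributes the powers in front.\<close>
  have "\<exists>P. poly P 0 = 1 \<and> (\<forall>\<epsilon>. \<epsilon> \<noteq> 0 \<longrightarrow>
    \<eta> (\<rho> (torus_element \<epsilon>) (\<rho> (h i) v)) = (h i $1$1 / \<epsilon>)^a * (m i / \<epsilon>)^b * poly P \<epsilon>)"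
    if i: "i \<in> I" for i
  proof -
    obtain x y w where cell: "\<And>\<epsilon>. \<epsilon> \<noteq> 0 \<Longrightarrow> \<exists>b\<in>borel_subgroup.
       torus_element \<epsilon> ** h i = lower_unipotent (\<epsilon> * x) (\<epsilon>\<^sup>2 * y) (\<epsilon> * w) ** b \<and>
       b$1$1 = h i$1$1 / \<epsilon> \<and> b$1$1 * b$2$2 = m i / \<epsilon>"
      unfolding m_def using big_cell[OF h nz, OF i i i] by blast
    define u where "u = (\<lambda>\<epsilon>. lower_unipotent (\<epsilon> * x) (\<epsilon>\<^sup>2 * y) (\<epsilon> * w))"
    have id: "(\<lambda>t. t) \<in> poly_funs {\<lambda>t. t}"
      by (rule poly_funs.coord) simp
    have "(\<lambda>\<epsilon>. f (u \<epsilon>)) \<in> poly_funs {\<lambda>t. t}" if "f \<in> {\<lambda>g :: complex^3^3. g $ i $ j | i j. True}" for f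
    proof -
      have "(\<lambda>\<epsilon>. u \<epsilon> $ k $ l) \<in> poly_funs {\<lambda>t. t}" for k l
        using exhaust_3[of k] exhaust_3[of l] unfolding u_def lower_unipotent_def
        by (elim disjE) (simp_all only: vector_3, (intro poly_funs_intros id)+)
      with that show ?thesis by auto
    qed
    then obtain P where P: "\<And>\<epsilon>. p (u \<epsilon>) = poly P \<epsilon>"
      using poly_funs_univariate[OF poly_funs_comp[where \<gamma> = u, OF p(1)]] by blast
    have "u 0 = mat 1"
      by (simp add: u_def lower_unipotent_def vec_eq_iff forall_3 vector_3 mat_def)
    then have "poly P 0 = 1"
      using P[of 0] p(2)[OF SL3_one] \<rho>_one v_in \<eta> by simp
    moreover have "\<eta> (\<rho> (torus_element \<epsilon>) (\<rho> (h i) v)) = (h i $1$1 / \<epsilon>)^a * (m i / \<epsilon>)^b * poly P \<epsilon>"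
      if e: "\<epsilon> \<noteq> 0" for \<epsilon>
    proof -
      obtain g where g: "g \<in> borel_subgroup" "torus_element \<epsilon> ** h i = u \<epsilon> ** g"
        "g$1$1 = h i$1$1 / \<epsilon>" "g$1$1 * g$2$2 = m i / \<epsilon>"
        using cell[OF e] unfolding u_def by blast
      have gS: "g \<in> SL3" and uS: "u \<epsilon> \<in> SL3"
        using g lower_unipotent_SL3 by (auto simp: borel_subgroup_def u_def)
      have "\<rho> (torus_element \<epsilon>) (\<rho> (h i) v) = \<rho> (u \<epsilon> ** g) v"
        using \<rho>_mult[OF torus_element_SL3[OF e] h[OF i] v_in] g by simp
      also have "\<dots> = \<rho> (u \<epsilon>) (sc ((h i$1$1 / \<epsilon>)^a * (m i / \<epsilon>)^b) v)"
        unfolding \<rho>_mult[OF uS gS v_in] weight[OF g(1)] g(4) unfolding g(3) ..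
      also have "\<dots> = sc ((h i$1$1 / \<epsilon>)^a * (m i / \<epsilon>)^b) (\<rho> (u \<epsilon>) v)"
        using \<rho>_linear[OF uS] v_in by (simp add: linear_on_def)
      finally show ?thesis
        using \<eta>(1) \<rho>_in[OF uS v_in] p(2)[OF uS] P by (simp add: linear_on_def)
    qed
    ultimately show ?thesis by blast
  qed
  then obtain P where P0: "\<And>i. i \<in> I \<Longrightarrow> poly (P i) 0 = 1" and
    P: "\<And>i \<epsilon>. i \<in> I \<Longrightarrow> \<epsilon> \<noteq> 0 \<Longrightarrow>
    \<eta> (\<rho> (torus_element \<epsilon>) (\<rho> (h i) v)) = (h i $1$1 / \<epsilon>)^a * (m i / \<epsilon>)^b * poly (P i) \<epsilon>"
    by metis
  define R where "R = (\<Sum>i\<in>I. smult (c i * (h i $1$1 ^ a * m i ^ b)) (P i))"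
  have "poly R \<epsilon> = 0" if e: "\<epsilon> \<noteq> 0" for \<epsilon>
  proof -
    note T = torus_element_SL3[OF e]
    have vs: "vector_space ((*) :: complex \<Rightarrow> complex \<Rightarrow> complex)"
      by unfold_locales (auto simp: algebra_simps)
    have hv: "\<rho> (h i) v \<in> V" "\<rho> (torus_element \<epsilon>) (\<rho> (h i) v) \<in> V" if "i \<in> I" for i
      using \<rho>_in h T v_in that by auto
    have "(\<Sum>i\<in>I. sc (c i) (\<rho> (torus_element \<epsilon>) (\<rho> (h i) v)))
        = \<rho> (torus_element \<epsilon>) (\<Sum>i\<in>I. sc (c i) (\<rho> (h i) v))"
      by (rule linear_on_compose_sum[symmetric, OF vector_space_axioms \<rho>_linear[OF T] V_subspace
        vector_space_axioms]) (rule hv)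
    also have "\<dots> = 0"
      unfolding rel by (rule \<rho>_zero[OF T])
    finally have "\<eta> (\<Sum>i\<in>I. sc (c i) (\<rho> (torus_element \<epsilon>) (\<rho> (h i) v))) = \<eta> 0" by simp
    moreover have "\<eta> 0 = 0"
      using \<eta>(1) subspace_0[OF V_subspace] unfolding linear_on_def
      by (metis scale_zero_left mult_zero_left)
    ultimately have "(\<Sum>i\<in>I. c i * \<eta> (\<rho> (torus_element \<epsilon>) (\<rho> (h i) v))) = 0"
      using linear_on_compose_sum[OF vector_space_axioms \<eta>(1) V_subspace vs,
        of I "\<lambda>i. \<rho> (torus_element \<epsilon>) (\<rho> (h i) v)" c] hv by simp
    moreover have "c i * \<eta> (\<rho> (torus_element \<epsilon>) (\<rho> (h i) v))
        = poly (smult (c i * (h i $1$1 ^ a * m i ^ b)) (P i)) \<epsilon> / \<epsilon> ^ (a + b)" if "i \<in> I" for i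
      using P[OF that e] by (simp add: power_divide power_add)
    ultimately have "(\<Sum>i\<in>I. poly (smult (c i * (h i $1$1 ^ a * m i ^ b)) (P i)) \<epsilon> / \<epsilon> ^ (a + b)) = 0"
      by simp
    then have "poly R \<epsilon> / \<epsilon> ^ (a + b) = 0"
      unfolding R_def poly_sum sum_divide_distrib .
    with e show ?thesis by simp
  qed
  then have "poly R 0 = 0" by (rule poly_eqI_nonzero)
  then have "(\<Sum>i\<in>I. c i * (h i $1$1 ^ a * m i ^ b)) = 0"
    by (simp add: R_def poly_sum P0)
  then show ?thesis
    by (simp add: flag_kernel_translate_opposite h m_def)
qed

text \<open>Moving a point in general position to the opposite flag puts all translated
  \<open>h i\<close> in the big cell, where the limit argument applies. Irreducibility of the cone
  reaches the remaining points.\<close>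

lemma relation_transfer:
  assumes "finite I" and h: "\<And>i. i \<in> I \<Longrightarrow> h i \<in> SL3"
    and rel: "(\<Sum>i\<in>I. sc (c i) (\<rho> (h i) v)) = 0"
  shows "(\<Sum>i\<in>I. c i * flag_kernel a b (pair_action (h i) base_flag) z) = 0"
proof (cases "z \<in> incidence")
  case True
  define k where "k = (\<lambda>a b i z. bil (snd z) (fst (pair_action (h i) base_flag)) ^ a *
    bil (snd (pair_action (h i) base_flag)) (fst z) ^ b)"
  have k: "flag_kernel a b (pair_action (h i) base_flag) z = k a b i z" if "z \<in> incidence" for a b i z
    using that by (simp add: flag_kernel_def k_def)
  have "(\<Sum>i\<in>I. c i * k a b i z) = 0"
  \<comment> \<open>The test functions have exponents 1 because general position needs both factors
    non-zero, and a factor is invisible in the kernel when its exponent \<open>a\<close> or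
    \<open>b\<close> is 0.\<close>
  proof (rule incidence_irreducible_prod[OF \<open>finite I\<close>, where q = "k 1 1"])
    show "(\<lambda>z. \<Sum>i\<in>I. c i * k a b i z) \<in> poly_funs pair_coords"
      unfolding k_def by (intro poly_funs_sum poly_funs.mult[OF poly_funs.const] flag_kernel_poly)
    show "k 1 1 i \<in> poly_funs pair_coords" for i
      unfolding k_def by (rule flag_kernel_poly)
    show "\<exists>z\<in>incidence. k 1 1 i z \<noteq> 0" if "i \<in> I" for i
      using h[OF that] base_flag_incidence k[of "pair_action (h i) opposite_flag" 1 1 i]
      by (intro bexI[of _ "pair_action (h i) opposite_flag"])
        (auto simp: pair_action_incidence flag_kernel_invariant flag_kernel_base_opposite)
    show "z \<in> incidence" by fact
  next
    fix z assume z: "z \<in> incidence"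
    show "(\<Sum>i\<in>I. c i * k a b i z) * (\<Prod>i\<in>I. k 1 1 i z) = 0"
    \<comment> \<open>For empty \<open>I\<close> the sum is zero; otherwise a non-vanishing test
      function shows that both entries of \<open>z\<close> are non-zero.\<close>
    proof (cases "I = {} \<or> (\<exists>i\<in>I. k 1 1 i z = 0)")
      case True
      then show ?thesis using \<open>finite I\<close> by (auto simp: prod_zero_iff)
    next
      case False
      then have "fst z \<noteq> 0" "snd z \<noteq> 0" by (auto simp: k_def bil_def)
      then obtain g where g: "g \<in> SL3" "z = pair_action g opposite_flag"
        using opposite_flag_orbit[OF z] by blast
      define h' where "h' = (\<lambda>i. matrix_inv g ** h i)"
      have h': "h' i \<in> SL3" if "i \<in> I" for i
        using h[OF that] g by (simp add: h'_def SL3_mult SL3_inv)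
      have kh': "k a b i z = flag_kernel a b (pair_action (h' i) base_flag) opposite_flag"
        if "i \<in> I" for a b i
        using h[OF that] g k[OF z, of a b i]
        by (simp add: flag_kernel_move h'_def pair_action_mult SL3_inv)
      have "(\<Sum>i\<in>I. c i * flag_kernel a b (pair_action (h' i) base_flag) opposite_flag) = 0"
      proof (rule relation_at_opposite_flag[OF \<open>finite I\<close> h'])
        have "(\<Sum>i\<in>I. sc (c i) (\<rho> (h' i) v)) = (\<Sum>i\<in>I. sc (c i) (\<rho> (matrix_inv g) (\<rho> (h i) v)))"
          using g h v_in by (simp add: h'_def \<rho>_mult SL3_inv)
        also have "\<dots> = \<rho> (matrix_inv g) (\<Sum>i\<in>I. sc (c i) (\<rho> (h i) v))"
          using g h v_in \<rho>_in
          by (intro linear_on_compose_sum[symmetric, OF vector_space_axioms \<rho>_linear V_subspace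
            vector_space_axioms]) (auto simp: SL3_inv)
        also have "\<dots> = 0"
          unfolding rel by (rule \<rho>_zero[OF SL3_inv[OF g(1)]])
        finally show "(\<Sum>i\<in>I. sc (c i) (\<rho> (h' i) v)) = 0" .
      next
        fix i assume i: "i \<in> I"
        have "k 1 1 i z \<noteq> 0" using False i by blast
        then show "h' i $1$1 \<noteq> 0" "h' i $1$1 * h' i $2$2 - h' i $1$2 * h' i $2$1 \<noteq> 0"
          unfolding kh'[OF i] flag_kernel_translate_opposite[OF h'[OF i]] by auto
      qed
      then show ?thesis by (simp add: kh')
    qed
  qed
  then show ?thesis using True by (simp add: k)
qed (simp add: flag_kernel_def)

text \<open>The map is prescribed on a basis taken from the orbit of \<open>v\<close>, and the
  transfer of relations gives the same formula on the whole orbit, from which equivariance follows.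
  Its kernel is a subrepresentation not containing \<open>v\<close>, hence zero.\<close>

theorem embedding:
  obtains \<phi> where "equivariant_embedding sc V \<rho> \<phi>"
    and "\<phi> ` V = fspan {flag_kernel a b (pair_action h base_flag) | h. h \<in> SL3}"
proof -
  interpret vector_space_pair sc "fscale :: complex \<Rightarrow> (vec_covec \<Rightarrow> complex) \<Rightarrow> _" ..
  define K where "K = (\<lambda>h. flag_kernel a b (pair_action h base_flag))"
  obtain B where B: "B \<subseteq> orbit" "independent B" "orbit \<subseteq> span B"
    by (rule maximal_independent_subset)
  obtain h where h: "\<And>x. x \<in> B \<Longrightarrow> h x \<in> SL3 \<and> x = \<rho> (h x) v"
    using B(1) by (simp add: subset_iff) metis
  obtain \<phi> where lin: "Vector_Spaces.linear sc fscale \<phi>" and \<phi>B: "\<And>x. x \<in> B \<Longrightarrow> \<phi> x = K (h x)"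
    using linear_independent_extend[OF B(2), of "\<lambda>x. K (h x)"] by blast
  have \<phi>_orbit: "\<phi> (\<rho> g v) = K g" if g: "g \<in> SL3" for g
  proof -
    have "\<rho> g v \<in> span B" using B g by blast
    then obtain T r where T: "finite T" "T \<subseteq> B" "\<rho> g v = (\<Sum>x\<in>T. sc (r x) x)"
      unfolding span_explicit by blast
    \<comment> \<open>The basis expansion of \<open>\<rho> g v\<close> is written as one relation:
      \<open>None\<close> carries \<open>g\<close> with coefficient -1, and \<open>Some x\<close>
      carries the basis vector \<open>x\<close>.\<close>
    let ?c = "case_option (-1) r" and ?h = "case_option g h" and ?I = "insert None (Some ` T)"
    have "(\<Sum>i\<in>?I. ?c i * flag_kernel a b (pair_action (?h i) base_flag) z) = 0" for z
    proof (rule relation_transfer)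
      show "?h i \<in> SL3" if "i \<in> ?I" for i
        using that g h T by (auto split: option.splits)
      have "(\<Sum>x\<in>T. sc (r x) (\<rho> (h x) v)) = (\<Sum>x\<in>T. sc (r x) x)"
        using h T by (intro sum.cong) auto
      then show "(\<Sum>i\<in>?I. sc (?c i) (\<rho> (?h i) v)) = 0"
        using T by (simp add: sum.reindex)
    qed (use T in auto)
    then have eq: "K g z = (\<Sum>x\<in>T. r x * K (h x) z)" for z
      using T by (simp add: sum.reindex K_def)
    have "\<phi> (\<rho> g v) = (\<Sum>x\<in>T. fscale (r x) (\<phi> x))"
      unfolding T(3) by (simp add: linear_sum[OF lin] linear_scale[OF lin])
    also have "\<dots> = (\<Sum>x\<in>T. fscale (r x) (K (h x)))"
      using T \<phi>B by (intro sum.cong) auto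
    also have "\<dots> = K g"
      by (simp add: fun_eq_iff eq pointwise_def sum_fun_apply)
    finally show ?thesis .
  qed
  have img: "\<phi> ` V = fspan {K h | h. h \<in> SL3}"
  proof -
    have "\<phi> ` orbit = {K h | h. h \<in> SL3}"
      using \<phi>_orbit by (auto simp: image_iff) metis+
    then show ?thesis
      using linear_span_image[OF lin, of orbit] by (simp flip: V_eq_span_orbit)
  qed
  have equi: "\<phi> (\<rho> g w) z = \<phi> w (pair_action (matrix_inv g) z)" if g: "g \<in> SL3" and w: "w \<in> V" for g w z
  proof -
    from w have "w \<in> span orbit" by (simp flip: V_eq_span_orbit)
    then have "w \<in> V \<and> \<phi> (\<rho> g w) z = \<phi> w (pair_action (matrix_inv g) z)"
    proof (induction rule: span_induct_alt)
      case base
      show ?case using \<rho>_zero[OF g] linear_0[OF lin] subspace_0[OF V_subspace] by simp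
    next
      case (step c x y)
      then obtain h where h: "h \<in> SL3" "x = \<rho> h v" by blast
      then have x: "x \<in> V" "sc c x \<in> V" using \<rho>_in v_in subspace_scale[OF V_subspace] by auto
      have "\<phi> (\<rho> g x) = K (g ** h)"
        using \<phi>_orbit[of "g ** h"] \<rho>_mult g h v_in SL3_mult by simp
      then have "\<phi> (\<rho> g x) z = \<phi> x (pair_action (matrix_inv g) z)"
        using \<phi>_orbit[OF h(1)] g h
        by (simp add: K_def flag_kernel_move pair_action_mult SL3_inv SL3_inv_inv)
      moreover have "\<rho> g (sc c x + y) = sc c (\<rho> g x) + \<rho> g y"
        using \<rho>_linear[OF g] x step unfolding linear_on_def by auto
      ultimately show ?case
        using step x subspace_add[OF V_subspace]
        by (simp add: linear_add[OF lin] linear_scale[OF lin] pointwise_def)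
    qed
    then show ?thesis by blast
  qed
  have inj: "inj_on \<phi> V"
  proof -
    define U where "U = {w \<in> V. \<phi> w = 0}"
    have "subspace U"
      unfolding U_def using V_subspace
      by (auto simp: subspace_def linear_add[OF lin] linear_scale[OF lin] linear_0[OF lin])
    moreover have "\<rho> g ` U \<subseteq> U" if "g \<in> SL3" for g
      using equi[OF that] \<rho>_in[OF that] by (auto simp: U_def intro!: ext simp del: split_paired_All)
    moreover have "v \<notin> U"
    proof -
      have "\<phi> v = K (mat 1)" using \<phi>_orbit[OF SL3_one] \<rho>_one v_in by simp
      then have "\<phi> v opposite_flag = 1"
        by (simp add: K_def pair_action_one flag_kernel_base_opposite)
      then show ?thesis by (auto simp: U_def)
    qed
    ultimately have "U = {0}"
      using irreducible v_in unfolding irreducible_representation_def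
      by (metis (no_types, lifting) U_def mem_Collect_eq subsetI)
    show ?thesis
    proof (rule inj_onI)
      fix x y assume "x \<in> V" "y \<in> V" "\<phi> x = \<phi> y"
      then have "x - y \<in> U"
        using subspace_diff[OF V_subspace] by (simp add: U_def linear_diff[OF lin])
      then show "x = y" by (simp add: \<open>U = {0}\<close>)
    qed
  qed
  have "fspan {K h | h. h \<in> SL3} \<subseteq> coordinate_ring pair_coords incidence"
    by (intro fun_space.span_minimal coordinate_ring_subspace)
      (auto simp: K_def flag_kernel_coordinate_ring)
  then have "equivariant_embedding sc V \<rho> \<phi>"
    unfolding equivariant_embedding_def linear_on_def using inj img equi
    by (auto simp: linear_add[OF lin] linear_scale[OF lin])
  then show thesis using that img unfolding K_def by blast
qed

end

section \<open>Functions of a given bidegree\<close>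

definition hermitian :: "'w set \<Rightarrow> ('w \<Rightarrow> complex) \<Rightarrow> ('w \<Rightarrow> complex) \<Rightarrow> complex" where
  "hermitian W c d = (\<Sum>w\<in>W. c w * cnj (d w))"

lemma hermitian_simps:
  "hermitian W (c + c') d = hermitian W c d + hermitian W c' d"
  "hermitian W (c - c') d = hermitian W c d - hermitian W c' d"
  "hermitian W (fscale k c) d = k * hermitian W c d"
  "hermitian W c (d + d') = hermitian W c d + hermitian W c d'"
  "hermitian W c (fscale k d) = cnj k * hermitian W c d"
  "hermitian W c 0 = 0"
  by (simp_all add: hermitian_def pointwise_def sum.distrib sum_subtractf sum_distrib_left algebra_simps)

lemma hermitian_self_zero:
  assumes "finite W" "hermitian W e e = 0" "w \<in> W"
  shows "e w = 0"
proof -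
  have "hermitian W e e = of_real (\<Sum>w\<in>W. (cmod (e w))\<^sup>2)"
    unfolding hermitian_def of_real_sum by (intro sum.cong refl complex_norm_square[symmetric])
  then have "(\<Sum>w\<in>W. (cmod (e w))\<^sup>2) = 0"
    using assms(2) by (metis of_real_eq_0_iff)
  then show ?thesis using assms by (simp add: sum_nonneg_eq_0_iff)
qed

lemma hermitian_orthogonal_span:
  assumes "\<And>b. b \<in> B \<Longrightarrow> hermitian W e b = 0" "x \<in> fspan B"
  shows "hermitian W e x = 0"
  using assms(2)
proof (induction rule: fun_space.span_induct_alt)
  case base
  show "hermitian W e 0 = 0" by (rule hermitian_simps)
next
  case (step c x y)
  then show "hermitian W e (fscale c x + y) = 0"
    by (simp only: hermitian_simps assms(1) mult_zero_right add_0)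
qed

text \<open>Gram-Schmidt: the new \<open>d\<close> is replaced by its part \<open>e\<close>
  orthogonal to the old span, and the projection of \<open>c\<close> is corrected by a multiple of
  \<open>e\<close>. Orthogonality to \<open>d\<close> follows as \<open>d - e\<close> lies in the
  old span.\<close>

lemma hermitian_projection:
  assumes "finite W" "finite B"
  shows "\<exists>s\<in>fspan B. \<forall>b\<in>B. hermitian W (c - s) b = 0"
  using assms(2)
proof (induction B arbitrary: c)
  case (insert d B)
  obtain p where p: "p \<in> fspan B" "\<And>b. b \<in> B \<Longrightarrow> hermitian W (d - p) b = 0"
    using insert.IH[of d] by blast
  obtain q where q: "q \<in> fspan B" "\<And>b. b \<in> B \<Longrightarrow> hermitian W (c - q) b = 0"
    using insert.IH[of c] by blast
  define e where "e = d - p"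
  \<comment> \<open>If \<open>e\<close> has norm 0, division by zero makes \<open>k\<close> zero.
    This is the right value, as \<open>e\<close> then vanishes on \<open>W\<close> and is orthogonal
    to everything.\<close>
  define k where "k = hermitian W c e / hermitian W e e"
  have sub: "fspan B \<subseteq> fspan (insert d B)"
    by (intro fun_space.span_mono) auto
  have e_in: "e \<in> fspan (insert d B)"
    unfolding e_def using p(1) sub fun_space.span_base[of d "insert d B"]
    by (intro fun_space.span_diff) auto
  have e_orth: "hermitian W x e = 0" if "x \<in> fspan B" for x
  proof -
    have "hermitian W e x = 0"
      using hermitian_orthogonal_span[of B W e x] p that by (simp add: e_def)
    moreover have "hermitian W x e = cnj (hermitian W e x)"
      by (simp add: hermitian_def mult.commute)
    ultimately show ?thesis by simp
  qed
  have ke: "hermitian W c e = k * hermitian W e e"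
  proof (cases "hermitian W e e = 0")
    case True
    have "e w = 0" if "w \<in> W" for w
      using hermitian_self_zero[OF assms(1) True that] .
    then show ?thesis by (simp add: hermitian_def)
  qed (simp add: k_def)
  define s where "s = q + fscale k e"
  have orth_B: "hermitian W (c - s) b = 0" if "b \<in> B" for b
    using q(2)[OF that] p(2)[OF that] by (simp add: s_def hermitian_simps e_def algebra_simps)
  have "hermitian W (c - s) p = 0"
    by (rule hermitian_orthogonal_span[OF orth_B p(1)])
  moreover have "hermitian W (c - s) e = 0"
    using e_orth[OF q(1)] ke by (simp add: s_def hermitian_simps)
  ultimately have "hermitian W (c - s) (e + p) = 0"
    by (simp only: hermitian_simps(4) add_0)
  moreover have "e + p = d" by (simp add: e_def)
  ultimately have "hermitian W (c - s) d = 0" by metis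
  moreover have "s \<in> fspan (insert d B)"
    unfolding s_def using q sub e_in by (intro fun_space.span_add fun_space.span_scale) auto
  ultimately show ?case using orth_B by blast
qed (auto intro: fun_space.span_zero)

text \<open>\<open>S\<close> may be infinite, but the support condition places it in the span of the
  indicator functions of the points of the finite set \<open>W\<close>, so an independent subset is
  finite.\<close>

lemma orthogonal_decomposition:
  assumes W: "finite W" and supp: "\<And>f w. f \<in> S \<Longrightarrow> w \<notin> W \<Longrightarrow> f w = 0"
  obtains s where "s \<in> fspan S" "\<And>f. f \<in> S \<Longrightarrow> hermitian W (c - s) f = 0"
proof -
  let ?T = "(\<lambda>w u. if u = w then 1 else 0 :: complex) ` W"
  obtain B where B: "B \<subseteq> S" "fun_space.independent B" "S \<subseteq> fspan B"
    by (rule fun_space.maximal_independent_subset)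
  have "f \<in> fspan ?T" if "f \<in> S" for f
  proof -
    have "f = (\<Sum>w\<in>W. fscale (f w) (\<lambda>u. if u = w then 1 else 0))"
    proof
      fix u
      have "f u = (if u \<in> W then f u else 0)" using supp[OF that] by simp
      then show "f u = (\<Sum>w\<in>W. fscale (f w) (\<lambda>u. if u = w then 1 else 0)) u"
        using W by (simp add: sum_fun_apply pointwise_def if_distrib cong: if_cong)
    qed
    moreover have "(\<Sum>w\<in>W. fscale (f w) (\<lambda>u. if u = w then 1 else 0)) \<in> fspan ?T"
      by (intro fun_space.span_sum fun_space.span_scale fun_space.span_base) auto
    ultimately show ?thesis by metis
  qed
  then have "B \<subseteq> fspan ?T" using B by blast
  then have "finite B" using fun_space.independent_span_bound[of ?T B] W B by auto
  then obtain s where s: "s \<in> fspan B" "\<And>b. b \<in> B \<Longrightarrow> hermitian W (c - s) b = 0"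
    using hermitian_projection[OF W] by blast
  show thesis
  proof (rule that)
    show "s \<in> fspan S" using s fun_space.span_mono[OF B(1)] by blast
    show "hermitian W (c - s) f = 0" if "f \<in> S" for f
      using hermitian_orthogonal_span[of B W "c - s" f] s B that by blast
  qed
qed

section \<open>Monomials indexed by words, and the span of the kernels\<close>

definition word_monomial :: "3 list \<Rightarrow> complex^3 \<Rightarrow> complex" where
  "word_monomial ks A = prod_list (map (($) A) ks)"

definition pair_monomial :: "3 list \<times> 3 list \<Rightarrow> vec_covec \<Rightarrow> complex" where
  "pair_monomial w z = word_monomial (fst w) (snd z) * word_monomial (snd w) (fst z)"

text \<open>The degree in \<open>\<ell>\<close> comes first, and likewise the scalar acting on \<open>\<ell>\<close> in \<open>pair_scale\<close> below.\<close>

definition bidegree :: "3 list \<times> 3 list \<Rightarrow> nat \<times> nat" where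
  "bidegree w = (length (fst w), length (snd w))"

lemma finite_bidegree: "finite {w. bidegree w = d}"
proof -
  have "finite {ks :: 3 list. length ks = n}" for n
    using finite_lists_length_eq[of "UNIV :: 3 set" n] by simp
  then have "finite ({ks :: 3 list. length ks = fst d} \<times> {ks :: 3 list. length ks = snd d})"
    by blast
  then show ?thesis
    by (rule finite_subset[rotated]) (auto simp: bidegree_def)
qed

text \<open>Words index monomials with repetition, unlike exponent vectors; in exchange no
  multinomial coefficients occur.\<close>

lemma bil_power: "bil l A ^ n = (\<Sum>ks | length ks = n. word_monomial ks l * word_monomial ks A)"
proof (induction n)
  case 0
  then show ?case by (simp add: word_monomial_def)
next
  case (Suc n)
  have eq: "{ks :: 3 list. length ks = Suc n} = (\<lambda>(k, ks). k # ks) ` (UNIV \<times> {ks. length ks = n})"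
    by (auto simp: length_Suc_conv)
  have inj: "inj_on (\<lambda>(k, ks). k # ks) (UNIV \<times> {ks :: 3 list. length ks = n})"
    by (auto simp: inj_on_def)
  have "(\<Sum>ks | length ks = Suc n. word_monomial ks l * word_monomial ks A)
    = (\<Sum>(k, ks)\<in>UNIV \<times> {ks. length ks = n}. (l $ k * A $ k) * (word_monomial ks l * word_monomial ks A))"
    unfolding eq sum.reindex[OF inj] by (intro sum.cong) (auto simp: word_monomial_def)
  also have "\<dots> = bil l A * (\<Sum>ks | length ks = n. word_monomial ks l * word_monomial ks A)"
    by (simp add: bil_def sum_product sum.cartesian_product)
  finally show ?case using Suc by simp
qed

text \<open>The kernel pairs the monomial vectors of \<open>z\<close> and \<open>w\<close>. The swap
  is there because the covector of \<open>z\<close> meets the vector of \<open>w\<close>, and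
  conversely.\<close>

lemma flag_kernel_expansion:
  assumes "z \<in> incidence"
  shows "flag_kernel a b w z =
    (\<Sum>u | bidegree u = (a, b). pair_monomial u z * pair_monomial u (prod.swap w))"
proof -
  have eq: "{u. bidegree u = (a, b)} = {ks. length ks = a} \<times> {ks. length ks = b}"
    by (auto simp: bidegree_def)
  have "flag_kernel a b w z = (\<Sum>ks | length ks = a. word_monomial ks (snd z) * word_monomial ks (fst w))
    * (\<Sum>ks | length ks = b. word_monomial ks (snd w) * word_monomial ks (fst z))"
    using assms by (simp add: flag_kernel_def bil_power)
  also have "\<dots> = (\<Sum>u\<in>{ks. length ks = a} \<times> {ks. length ks = b}.
      pair_monomial u z * pair_monomial u (prod.swap w))"
    by (simp add: sum_product sum.cartesian_product pair_monomial_def mult_ac case_prod_unfold)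
  finally show ?thesis unfolding eq .
qed

lemma word_monomial_poly:
  assumes "\<And>k. (\<lambda>z. f z $ k) \<in> poly_funs C"
  shows "(\<lambda>z. word_monomial ks (f z)) \<in> poly_funs C"
  unfolding word_monomial_def by (induction ks) (auto intro: poly_funs.intros assms)

lemma pair_monomial_poly: "pair_monomial w \<in> poly_funs pair_coords"
  unfolding pair_monomial_def
  by (intro poly_funs.mult word_monomial_poly pair_coords_poly)

text \<open>The kernels of the non-degenerate flags span all functions of bidegree \<open>(a, b)\<close>: a coefficient
  vector orthogonal to all of them gives, since the variety is stable under complex conjugation,
  a polynomial vanishing on the variety.\<close>

lemma pair_monomial_in_span:
  assumes "bidegree w = (a, b)"
  shows "(\<lambda>z. if z \<in> incidence then pair_monomial w z else 0)
    \<in> fspan {flag_kernel a b (pair_action h base_flag) | h. h \<in> SL3}" (is "_ \<in> fspan ?K")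
proof -
  define W where "W = {u. bidegree u = (a, b)}"
  define X where "X = {z \<in> incidence. fst z \<noteq> 0 \<and> snd z \<noteq> 0}"
  \<comment> \<open>The coefficients over words of the kernel of the flag \<open>z\<close>, cut off
    outside \<open>W\<close>.\<close>
  define m where "m = (\<lambda>z u. if u \<in> W then pair_monomial u (prod.swap z) else 0)"
  have W: "finite W" unfolding W_def by (rule finite_bidegree)
  \<comment> \<open>The coefficient vector of the given monomial; \<open>F\<close> below turns
    coefficient vectors into functions on the cone.\<close>
  define c where "c = (\<lambda>u. if u = w then 1 else 0 :: complex)"
  define F where "F = (\<lambda>c z. if z \<in> incidence then \<Sum>u\<in>W. c u * pair_monomial u z else 0)"
  obtain s where s: "s \<in> fspan (m ` X)" "\<And>f. f \<in> m ` X \<Longrightarrow> hermitian W (c - s) f = 0"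
  proof (rule orthogonal_decomposition[OF W])
    show "f u = 0" if "f \<in> m ` X" "u \<notin> W" for f u
      using that by (auto simp: m_def)
  qed blast
  have F_linear: "F (fscale k x + y) = fscale k (F x) + F y" for k x y
    by (simp add: F_def fun_eq_iff pointwise_def sum.distrib sum_distrib_left algebra_simps)
  have Fs: "F s \<in> fspan ?K"
    using s(1)
  proof (induction rule: fun_space.span_induct_alt)
    case base
    have "F 0 = 0" by (simp add: F_def fun_eq_iff)
    then show "F 0 \<in> fspan ?K" by (simp only: fun_space.span_zero)
  next
    case (step k x y)
    then obtain \<omega> where \<omega>: "\<omega> \<in> X" "x = m \<omega>" by blast
    then obtain h where h: "h \<in> SL3" "pair_action h base_flag = \<omega>"
      using SL3_transitive[of "fst \<omega>" "snd \<omega>"] by (auto simp: X_def)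
    have "F (m \<omega>) = flag_kernel a b \<omega>"
      by (rule ext, simp add: F_def flag_kernel_expansion flip: W_def)
        (simp add: m_def flag_kernel_def mult.commute)
    then have "F x \<in> ?K" using \<omega> h by blast
    then show "F (fscale k x + y) \<in> fspan ?K"
      unfolding F_linear using step(2)
      by (intro fun_space.span_add fun_space.span_scale) (auto intro: fun_space.span_base)
  qed
  have orth: "(\<Sum>u\<in>W. (c - s) u * pair_monomial u z) = 0" if "z \<in> incidence" for z
  proof (rule incidence_density[OF _ _ that])
    show "(\<lambda>z. \<Sum>u\<in>W. (c - s) u * pair_monomial u z) \<in> poly_funs pair_coords"
      by (intro poly_funs_sum poly_funs.mult poly_funs.const pair_monomial_poly)
  next
    fix z :: vec_covec assume z: "z \<in> incidence" "fst z \<noteq> 0" "snd z \<noteq> 0"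
    define cv where "cv = (\<lambda>A :: complex^3. \<chi> k. cnj (A $ k))"
    \<comment> \<open>The conjugated pair with its entries exchanged. The swap in \<open>m\<close>
      and the conjugation in \<open>hermitian\<close> undo both changes, so orthogonality to
      \<open>m \<omega>\<close> means vanishing at \<open>z\<close>.\<close>
    define \<omega> where "\<omega> = (cv (snd z), cv (fst z))"
    have "cnj (bil (snd z) (fst z)) = bil (snd \<omega>) (fst \<omega>)"
      by (simp add: \<omega>_def cv_def bil_3 mult.commute)
    moreover have "cv A \<noteq> 0" if "A \<noteq> 0" for A
      using that by (simp add: cv_def vec_eq_iff)
    ultimately have "\<omega> \<in> X"
      using z by (simp add: X_def incidence_bil) (simp add: \<omega>_def)
    have word: "word_monomial ks (cv A) = cnj (word_monomial ks A)" for ks A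
      unfolding word_monomial_def by (induction ks) (simp_all add: cv_def)
    have "hermitian W (c - s) (m \<omega>) = 0"
      using s(2) \<open>\<omega> \<in> X\<close> by blast
    then show "(\<Sum>u\<in>W. (c - s) u * pair_monomial u z) = 0"
      by (simp add: hermitian_def m_def pair_monomial_def \<omega>_def word)
  qed
  have "(\<lambda>z. if z \<in> incidence then pair_monomial w z else 0) = F s"
  proof
    fix z
    have "(\<Sum>u\<in>W. c u * pair_monomial u z) = pair_monomial w z"
      using W assms by (simp add: c_def W_def if_distrib[of "\<lambda>k. k * _"] cong: if_cong)
    then show "(if z \<in> incidence then pair_monomial w z else 0) = F s z"
      using orth[of z] by (simp add: F_def left_diff_distrib sum_subtractf)
  qed
  with Fs show ?thesis by simp
qed

section \<open>Scaling by bidegree\<close>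

definition pair_scale :: "complex \<times> complex \<Rightarrow> vec_covec \<Rightarrow> vec_covec" where
  "pair_scale s z = (snd s *s fst z, fst s *s snd z)"

lemma bil_scale: "bil (c *s l) A = c * bil l A" "bil l (c *s A) = c * bil l A"
  by (simp_all add: bil_3 algebra_simps)

lemma pair_scale_incidence: "z \<in> incidence \<Longrightarrow> pair_scale s z \<in> incidence"
  by (simp add: incidence_bil pair_scale_def bil_scale)

lemma span_flag_kernel_scale:
  assumes "f \<in> fspan {flag_kernel a b (pair_action h base_flag) | h. h \<in> SL3}" "z \<in> incidence"
  shows "f (pair_scale s z) = fst s ^ a * snd s ^ b * f z"
  using assms(1)
proof (induction rule: fun_space.span_induct_alt)
  case (step c x y)
  then obtain h where "x = flag_kernel a b (pair_action h base_flag)" by blast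
  then have "x (pair_scale s z) = fst s ^ a * snd s ^ b * x z"
    using assms(2) pair_scale_incidence[OF assms(2)]
    by (simp add: flag_kernel_def) (simp add: pair_scale_def bil_scale power_mult_distrib)
  then show ?case using step by (simp add: pointwise_def algebra_simps)
qed simp

lemma word_monomial_scale: "word_monomial ks (c *s A) = c ^ length ks * word_monomial ks A"
  unfolding word_monomial_def by (induction ks) (simp_all add: algebra_simps)

lemma pair_monomial_scale:
  "pair_monomial w (pair_scale s z) = fst s ^ fst (bidegree w) * snd s ^ snd (bidegree w) * pair_monomial w z"
  by (simp add: pair_monomial_def pair_scale_def word_monomial_scale bidegree_def)

section \<open>Tensor products of embedded representations\<close>

text \<open>Evaluations separate the vectors because \<open>\<phi>\<close> is injective, so finitely
  many of them suffice to reconstruct a finite-dimensional \<open>V\<close>. The induction over the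
  spanning set adds a point only if the new vector is not yet reproduced.\<close>

lemma dual_points:
  assumes "vector_space sc" "module.subspace sc V" "finite B" "module.span sc B = V"
    and lin: "linear_on sc fscale V \<phi>" and inj: "inj_on \<phi> V"
  obtains N :: nat and pt w where "\<And>j. j < N \<Longrightarrow> w j \<in> V"
    and "\<And>x. x \<in> V \<Longrightarrow> x = (\<Sum>j<N. sc (\<phi> x (pt j)) (w j))"
proof -
  interpret vector_space sc by fact
  note V = \<open>subspace V\<close>
  have add: "\<phi> (x + y) z = \<phi> x z + \<phi> y z" if "x \<in> V" "y \<in> V" for x y z
    using lin that by (simp add: linear_on_def)
  have scale: "\<phi> (sc c x) z = c * \<phi> x z" if "x \<in> V" for c x z
    using lin that by (simp add: linear_on_def pointwise_def)
  have zero: "\<phi> 0 z = 0" for z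
    using scale[of 0 0 z] subspace_0[OF V] by simp
  have sum: "\<phi> (\<Sum>j<N. sc (c j) (w j)) z = (\<Sum>j<N. c j * \<phi> (w j) z)"
    if "\<And>j. j < N \<Longrightarrow> w j \<in> V" for N :: nat and c w z
    using that
  proof (induction N)
    case (Suc N)
    then have "(\<Sum>j<N. sc (c j) (w j)) \<in> V" "sc (c N) (w N) \<in> V"
      by (auto intro!: subspace_sum[OF V] subspace_scale[OF V])
    with Suc show ?case by (simp add: add scale)
  qed (simp add: zero)
  have "B \<subseteq> V" using assms(4) span_superset by blast
  with \<open>finite B\<close> have "\<exists>N :: nat. \<exists>pt w. (\<forall>j<N. w j \<in> V) \<and>
    (\<forall>x\<in>span B. x = (\<Sum>j<N. sc (\<phi> x (pt j)) (w j)))"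
  proof induction
    case empty
    show ?case by (rule exI[of _ 0]) simp
  next
    case (insert b B)
    then obtain N :: nat and pt w where w: "\<And>j. j < N \<Longrightarrow> w j \<in> V"
      and IH: "\<And>x. x \<in> span B \<Longrightarrow> x = (\<Sum>j<N. sc (\<phi> x (pt j)) (w j))"
      by (metis insert_subset)
    define \<pi> where "\<pi> = (\<lambda>x. \<Sum>j<N. sc (\<phi> x (pt j)) (w j))"
    have \<pi>_in: "\<pi> x \<in> V" for x
      unfolding \<pi>_def using w by (auto intro!: subspace_sum[OF V] subspace_scale[OF V])
    have bV: "b \<in> V" and BV: "span B \<subseteq> V"
      using insert.prems by (auto intro: span_minimal[OF _ V, THEN subsetD])
    define e where "e = b - \<pi> b"
    have eV: "e \<in> V" unfolding e_def using subspace_diff[OF V bV \<pi>_in] .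
    \<comment> \<open>The defect of the reconstruction \<open>\<pi>\<close> is zero on the old span,
      so on the enlarged span it takes values in the line through \<open>e\<close>.\<close>
    have decomp: "\<exists>k. x - \<pi> x = sc k e" if x: "x \<in> span (insert b B)" for x
    proof -
      obtain k where k: "x - sc k b \<in> span B"
        using x by (auto simp: span_insert)
      define y where "y = x - sc k b"
      have xy: "x = sc k b + y" by (simp add: y_def)
      have y: "y \<in> span B" "y \<in> V" using k BV by (auto simp: y_def)
      have "\<phi> x z = k * \<phi> b z + \<phi> y z" for z
        unfolding xy using y bV by (simp add: add scale subspace_scale[OF V])
      then have "\<pi> x = sc k (\<pi> b) + \<pi> y"
        by (simp add: \<pi>_def scale_left_distrib sum.distrib scale_sum_right)
      moreover have "\<pi> y = y" using IH[OF y(1)] by (simp add: \<pi>_def)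
      ultimately have "x - \<pi> x = sc k e"
        by (simp add: xy e_def scale_right_diff_distrib)
      then show ?thesis by blast
    qed
    have spanV: "span (insert b B) \<subseteq> V"
      using insert.prems by (intro span_minimal V)
    show ?case
    proof (cases "e = 0")
      case True
      then have "x = (\<Sum>j<N. sc (\<phi> x (pt j)) (w j))" if "x \<in> span (insert b B)" for x
        using decomp[OF that] by (auto simp: \<pi>_def)
      with w show ?thesis by blast
    next
      case False
      have "\<phi> e \<noteq> 0"
      proof
        assume "\<phi> e = 0"
        then have "\<phi> e = \<phi> 0" using zero by (simp add: fun_eq_iff)
        then show False using inj eV subspace_0[OF V] False by (auto dest: inj_onD)
      qed
      then obtain z where z: "\<phi> e z \<noteq> 0" by (auto simp: fun_eq_iff)
      define f where "f = sc (1 / \<phi> e z) e"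
      have fV: "f \<in> V" unfolding f_def using eV by (rule subspace_scale[OF V])
      \<comment> \<open>As \<open>f\<close> has value 1 at the new point \<open>z\<close>, this
        correction gives the old vectors the value 0 there.\<close>
      define u where "u = (\<lambda>j. w j - sc (\<phi> (w j) z) f)"
      have uV: "u j \<in> V" if "j < N" for j
        unfolding u_def using w[OF that] fV subspace_diff[OF V] subspace_scale[OF V] by blast
      have "x = (\<Sum>j<Suc N. sc (\<phi> x ((pt(N := z)) j)) ((u(N := f)) j))"
        if x: "x \<in> span (insert b B)" for x
      proof -
        have xV: "x \<in> V" using x spanV by blast
        obtain k where k: "x - \<pi> x = sc k e" using decomp[OF x] by blast
        then have xk: "x = \<pi> x + sc k e" by (simp add: algebra_simps)
        have "\<phi> x z = \<phi> (\<pi> x) z + k * \<phi> e z"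
          using xk add[OF \<pi>_in subspace_scale[OF V eV]] scale[OF eV] by metis
        also have "\<phi> (\<pi> x) z = (\<Sum>j<N. \<phi> x (pt j) * \<phi> (w j) z)"
          unfolding \<pi>_def using w by (rule sum)
        finally have kz: "k * \<phi> e z = \<phi> x z - (\<Sum>j<N. \<phi> x (pt j) * \<phi> (w j) z)" by simp
        have "sc k e = sc (k * \<phi> e z) f" using z by (simp add: f_def)
        then have "x = \<pi> x + sc (\<phi> x z - (\<Sum>j<N. \<phi> x (pt j) * \<phi> (w j) z)) f"
          using xk kz by metis
        also have "\<dots> = (\<Sum>j<N. sc (\<phi> x (pt j)) (u j)) + sc (\<phi> x z) f"
          by (simp add: \<pi>_def u_def scale_right_diff_distrib sum_subtractf scale_left_diff_distrib
            scale_sum_left)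
        finally show ?thesis by simp
      qed
      moreover have "(u(N := f)) j \<in> V" if "j < Suc N" for j
        using that uV fV by (auto simp: less_Suc_eq)
      ultimately show ?thesis by blast
    qed
  qed
  then show thesis using that assms(4) by metis
qed

section \<open>Tensors as functions of n pairs\<close>

locale tensor_setup = vector_space sc
  for sc :: "complex \<Rightarrow> 'v::ab_group_add \<Rightarrow> 'v" +
  fixes V :: "'n::finite \<Rightarrow> 'v set" and \<rho> :: "'n \<Rightarrow> complex^3^3 \<Rightarrow> 'v \<Rightarrow> 'v"
    and \<phi> :: "'n \<Rightarrow> 'v \<Rightarrow> vec_covec \<Rightarrow> complex"
  assumes rep: "\<And>i. SL3_representation sc (V i) (\<rho> i)"
    and embed: "\<And>i. equivariant_embedding sc (V i) (\<rho> i) (\<phi> i)"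
begin

lemma V_subspace: "subspace (V i)"
  using rep[of i] unfolding SL3_representation_def by (rule conjunct1)

lemma \<rho>_linear: "g \<in> SL3 \<Longrightarrow> linear_on sc sc (V i) (\<rho> i g)"
  and \<rho>_in: "g \<in> SL3 \<Longrightarrow> x \<in> V i \<Longrightarrow> \<rho> i g x \<in> V i"
proof -
  have *: "\<forall>g\<in>SL3. linear_on sc sc (V i) (\<rho> i g) \<and> \<rho> i g ` V i \<subseteq> V i"
    using rep[of i] unfolding SL3_representation_def by (elim conjE)
  show "g \<in> SL3 \<Longrightarrow> linear_on sc sc (V i) (\<rho> i g)" using * by blast
  show "g \<in> SL3 \<Longrightarrow> x \<in> V i \<Longrightarrow> \<rho> i g x \<in> V i" using * by blast
qed

lemma \<rho>_inv_cancel: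
  assumes "g \<in> SL3" "x \<in> V i"
  shows "\<rho> i g (\<rho> i (matrix_inv g) x) = x"
proof -
  have 1: "\<forall>x\<in>V i. \<rho> i (mat 1) x = x"
    using rep[of i] unfolding SL3_representation_def by (elim conjE)
  have 2: "\<forall>g\<in>SL3. \<forall>h\<in>SL3. \<forall>v\<in>V i. \<rho> i (g ** h) v = \<rho> i g (\<rho> i h v)"
    using rep[of i] unfolding SL3_representation_def by (elim conjE)
  show ?thesis
    using 1 2[rule_format, of g "matrix_inv g" x] assms SL3_inv SL3_inv_right by simp
qed

text \<open>Tensors are functionals on multilinear forms, so applying one to this product of point
  evaluations gives the value at \<open>z\<close> of the function it represents.\<close>

definition eval_form :: "('n \<Rightarrow> vec_covec) \<Rightarrow> ('n \<Rightarrow> 'v) \<Rightarrow> complex" where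
  "eval_form z v = (\<Prod>i\<in>UNIV. \<phi> i (v i) (z i))"

abbreviation "TP \<equiv> tensor_product sc V"
abbreviation "pure \<equiv> pure_tensor sc V"
abbreviation "multilinear \<equiv> multilinear_form sc V"
abbreviation "on_V v \<equiv> \<forall>i. v i \<in> V i"

lemma \<phi>_linear: "x \<in> V i \<Longrightarrow> y \<in> V i \<Longrightarrow> \<phi> i (x + y) z = \<phi> i x z + \<phi> i y z"
  "x \<in> V i \<Longrightarrow> \<phi> i (sc c x) z = c * \<phi> i x z"
  using embed[of i] by (simp_all add: equivariant_embedding_def linear_on_def pointwise_def)

lemma \<phi>_outside: "x \<in> V i \<Longrightarrow> z \<notin> incidence \<Longrightarrow> \<phi> i x z = 0"
  using embed[of i] unfolding equivariant_embedding_def coordinate_ring_def by blast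

lemma \<phi>_equivariant:
  assumes "g \<in> SL3" "x \<in> V i"
  shows "\<phi> i (\<rho> i g x) z = \<phi> i x (pair_action (matrix_inv g) z)"
proof (cases "z \<in> incidence")
  case True
  then show ?thesis using embed[of i] assms unfolding equivariant_embedding_def by blast
next
  case False
  then show ?thesis
    using \<phi>_outside[OF \<rho>_in[OF assms]] \<phi>_outside[OF assms(2)] pair_action_incidence[OF SL3_inv[OF assms(1)]]
    by metis
qed

lemma multilinear_eval_form: "multilinear (eval_form z)"
proof -
  have "eval_form z (v(i := x)) = \<phi> i x (z i) * (\<Prod>j\<in>UNIV - {i}. \<phi> j (v j) (z j))" for v i x
  proof -
    have "eval_form z (v(i := x)) = \<phi> i x (z i) * (\<Prod>j\<in>UNIV - {i}. \<phi> j ((v(i := x)) j) (z j))"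
      unfolding eval_form_def by (subst prod.remove[of UNIV i]) auto
    also have "(\<Prod>j\<in>UNIV - {i}. \<phi> j ((v(i := x)) j) (z j)) = (\<Prod>j\<in>UNIV - {i}. \<phi> j (v j) (z j))"
      by (rule prod.cong) auto
    finally show ?thesis .
  qed
  then show ?thesis
    by (simp add: multilinear_form_def linear_on_def \<phi>_linear algebra_simps)
qed

text \<open>Forms are total functions on the ambient type, but multilinearity only sees their values
  on families in the \<open>V i\<close>.\<close>

lemma multilinear_cong:
  assumes "\<And>v. on_V v \<Longrightarrow> \<beta> v = \<beta>' v"
  shows "multilinear \<beta> \<longleftrightarrow> multilinear \<beta>'"
proof -
  have "\<beta> (v(i := x)) = \<beta>' (v(i := x))" if "on_V v" "x \<in> V i" for v i x
    using that by (intro assms) auto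
  moreover have "x + y \<in> V i" "sc c x \<in> V i" if "x \<in> V i" "y \<in> V i" for x y i c
    using that subspace_add[OF V_subspace] subspace_scale[OF V_subspace] by auto
  ultimately show ?thesis
    unfolding multilinear_form_def linear_on_def by (simp cong: conj_cong)
qed

lemma TP_induct [consumes 1, case_names zero step]:
  assumes "T \<in> TP" "P 0"
    "\<And>c v T. on_V v \<Longrightarrow> T \<in> TP \<Longrightarrow> P T \<Longrightarrow> P (fscale c (pure v) + T)"
  shows "P T"
proof -
  have "T \<in> TP \<and> P T"
    using assms(1) unfolding tensor_product_def
  proof (induction rule: fun_space.span_induct_alt)
    case base
    then show ?case using assms(2) fun_space.span_zero by blast
  next
    case (step c x y)
    then obtain v where v: "on_V v" "x = pure v" by blast
    show ?case
    proof
      show "fscale c x + y \<in> fspan {pure v |v. on_V v}"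
        using step by (intro fun_space.span_add fun_space.span_scale) (auto intro: fun_space.span_base)
      show "P (fscale c x + y)"
        unfolding v(2) using step(2) by (intro assms(3)[OF v(1)]) (simp_all add: tensor_product_def)
    qed
  qed
  then show ?thesis ..
qed

lemma TP_subspace: "module.subspace fscale TP"
  unfolding tensor_product_def by (rule fun_space.subspace_span)

lemma pure_in_TP: "on_V v \<Longrightarrow> pure v \<in> TP"
  unfolding tensor_product_def by (rule fun_space.span_base) auto

lemma TP_cong:
  assumes "T \<in> TP" and eq: "\<And>v. on_V v \<Longrightarrow> \<beta> v = \<beta>' v"
  shows "T \<beta> = T \<beta>'"
  using assms(1)
proof (induction rule: TP_induct)
  case (step c v T)
  then show ?case using multilinear_cong[OF eq] eq by (simp add: pointwise_def pure_tensor_def)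
qed simp

lemma TP_not_multilinear: "T \<in> TP \<Longrightarrow> \<not> multilinear \<beta> \<Longrightarrow> T \<beta> = 0"
  by (induction rule: TP_induct) (simp_all add: pointwise_def pure_tensor_def)

lemma multilinear_sum:
  assumes "multilinear \<beta>" "on_V v" "\<And>j. j \<in> I \<Longrightarrow> w j \<in> V i"
  shows "\<beta> (v(i := \<Sum>j\<in>I. sc (c j) (w j))) = (\<Sum>j\<in>I. c j * \<beta> (v(i := w j)))"
proof -
  have vs: "vector_space ((*) :: complex \<Rightarrow> complex \<Rightarrow> complex)"
    by unfold_locales (auto simp: algebra_simps)
  have "linear_on sc (*) (V i) (\<lambda>x. \<beta> (v(i := x)))"
    using assms unfolding multilinear_form_def by blast
  then show ?thesis
    by (rule linear_on_compose_sum[OF vector_space_axioms _ V_subspace vs]) (rule assms(3))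
qed

text \<open>The slots in \<open>S\<close> are expanded one after the other in the dual points, while
  the others keep their vectors. With \<open>S = UNIV\<close>, the form becomes a combination of
  evaluation forms on the \<open>V i\<close>.\<close>

lemma multilinear_expansion:
  assumes \<beta>: "multilinear \<beta>" and v: "on_V v" and w: "\<And>i j. j < N i \<Longrightarrow> w i j \<in> V i"
    and dual: "\<And>i x. x \<in> V i \<Longrightarrow> x = (\<Sum>j<N i. sc (\<phi> i x (pt i j)) (w i j))"
    and "finite S"
  shows "\<beta> v = (\<Sum>J\<in>PiE S (\<lambda>i. {..<N i}). (\<Prod>i\<in>S. \<phi> i (v i) (pt i (J i))) *
    \<beta> (\<lambda>i. if i \<in> S then w i (J i) else v i))"
  using \<open>finite S\<close>
proof induction
  case empty
  then show ?case by simp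
next
  case (insert i S)
  let ?u = "\<lambda>S J k. if k \<in> S then w k (J k) else v k"
  let ?P = "PiE S (\<lambda>i. {..<N i})"
  have inj: "inj_on (\<lambda>(j, J). J(i := j)) ({..<N i} \<times> ?P)"
    using insert.hyps(2) by (rule inj_combinator)
  have "\<beta> v = (\<Sum>J\<in>?P. (\<Prod>k\<in>S. \<phi> k (v k) (pt k (J k))) * \<beta> (?u S J))"
    by (rule insert.IH)
  also have "\<dots> = (\<Sum>J\<in>?P. \<Sum>j<N i. (\<Prod>k\<in>S. \<phi> k (v k) (pt k (J k))) *
      (\<phi> i (v i) (pt i j) * \<beta> (?u (insert i S) (J(i := j)))))"
  proof (rule sum.cong[OF refl])
    fix J assume J: "J \<in> ?P"
    have uV: "on_V (?u S J)"
      using J v w by (auto simp: PiE_def Pi_def)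
    have "?u S J = (?u S J)(i := v i)" using insert.hyps by (simp add: fun_eq_iff)
    also have "\<dots> = (?u S J)(i := \<Sum>j<N i. sc (\<phi> i (v i) (pt i j)) (w i j))"
      by (rule arg_cong[of _ _ "fun_upd (?u S J) i"]) (rule dual, use v in blast)
    finally have u: "?u S J = (?u S J)(i := \<Sum>j<N i. sc (\<phi> i (v i) (pt i j)) (w i j))" .
    have "\<beta> (?u S J) = (\<Sum>j<N i. \<phi> i (v i) (pt i j) * \<beta> ((?u S J)(i := w i j)))"
      by (subst u, rule multilinear_sum[OF \<beta> uV]) (simp add: w)
    moreover have "(?u S J)(i := w i j) = ?u (insert i S) (J(i := j))" for j
      using insert.hyps by (auto simp: fun_eq_iff)
    ultimately show "(\<Prod>k\<in>S. \<phi> k (v k) (pt k (J k))) * \<beta> (?u S J) =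
      (\<Sum>j<N i. (\<Prod>k\<in>S. \<phi> k (v k) (pt k (J k))) *
      (\<phi> i (v i) (pt i j) * \<beta> (?u (insert i S) (J(i := j)))))"
      by (simp add: sum_distrib_left)
  qed
  also have "\<dots> = (\<Sum>(j, J)\<in>{..<N i} \<times> ?P. (\<Prod>k\<in>S. \<phi> k (v k) (pt k (J k))) *
      (\<phi> i (v i) (pt i j) * \<beta> (?u (insert i S) (J(i := j)))))"
    by (subst sum.swap) (simp add: sum.cartesian_product)
  also have "\<dots> = (\<Sum>(j, J)\<in>{..<N i} \<times> ?P. (\<Prod>k\<in>insert i S. \<phi> k (v k) (pt k ((J(i := j)) k))) *
      \<beta> (?u (insert i S) (J(i := j))))"
  proof (rule sum.cong[OF refl], clarify)
    fix j J
    have "(\<Prod>k\<in>S. \<phi> k (v k) (pt k ((J(i := j)) k))) = (\<Prod>k\<in>S. \<phi> k (v k) (pt k (J k)))"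
      using insert.hyps by (intro prod.cong) auto
    then show "(\<Prod>k\<in>S. \<phi> k (v k) (pt k (J k))) * (\<phi> i (v i) (pt i j) * \<beta> (?u (insert i S) (J(i := j))))
      = (\<Prod>k\<in>insert i S. \<phi> k (v k) (pt k ((J(i := j)) k))) * \<beta> (?u (insert i S) (J(i := j)))"
      using insert.hyps by simp
  qed
  also have "\<dots> = (\<Sum>J\<in>PiE (insert i S) (\<lambda>i. {..<N i}).
      (\<Prod>k\<in>insert i S. \<phi> k (v k) (pt k (J k))) * \<beta> (?u (insert i S) J))"
    unfolding PiE_insert_eq sum.reindex[OF inj] by (simp add: case_prod_unfold)
  finally show ?case .
qed

text \<open>By the full expansion a tensor is determined on multilinear forms by its values on
  evaluation forms; on all other arguments it is 0.\<close>

lemma eval_forms_separate: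
  assumes T: "T \<in> TP" and zero: "\<And>z. T (eval_form z) = 0"
  shows "T = 0"
proof
  fix \<beta>
  show "T \<beta> = 0 \<beta>"
  proof (cases "multilinear \<beta>")
    case True
    let ?dual = "\<lambda>i (N :: nat, pt, w). (\<forall>j<N. w j \<in> V i) \<and> (\<forall>x\<in>V i. x = (\<Sum>j<N. sc (\<phi> i x (pt j)) (w j)))"
    have "\<forall>i. \<exists>d :: nat \<times> (nat \<Rightarrow> vec_covec) \<times> (nat \<Rightarrow> 'v). ?dual i d"
    proof
      fix i
      have "\<exists>B. finite B \<and> span B = V i"
        using rep[of i] unfolding SL3_representation_def by (elim conjE)
      then obtain B where B: "finite B" "span B = V i" by blast
      have lin: "linear_on sc fscale (V i) (\<phi> i)" and inj: "inj_on (\<phi> i) (V i)"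
        using embed[of i] by (simp_all add: equivariant_embedding_def)
      show "\<exists>d. ?dual i d"
      proof (rule dual_points[OF vector_space_axioms V_subspace B lin inj])
        fix N :: nat and pt w
        assume "\<And>j. j < N \<Longrightarrow> w j \<in> V i"
          "\<And>x. x \<in> V i \<Longrightarrow> x = (\<Sum>j<N. sc (\<phi> i x (pt j)) (w j))"
        then have "?dual i (N, pt, w)" by blast
        then show "\<exists>d. ?dual i d" by (rule exI)
      qed
    qed
    then obtain d :: "'n \<Rightarrow> nat \<times> (nat \<Rightarrow> vec_covec) \<times> (nat \<Rightarrow> 'v)" where d: "\<And>i. ?dual i (d i)"
      unfolding choice_iff by blast
    define N where "N = (\<lambda>i. fst (d i))"
    define pt where "pt = (\<lambda>i. fst (snd (d i)))"
    define w where "w = (\<lambda>i. snd (snd (d i)))"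
    have w: "w i j \<in> V i" if "j < N i" for i j
      using d[of i] that unfolding case_prod_unfold N_def w_def by blast
    have dual: "x = (\<Sum>j<N i. sc (\<phi> i x (pt i j)) (w i j))" if "x \<in> V i" for i x
      using d[of i] that unfolding case_prod_unfold N_def w_def pt_def by blast
    let ?P = "PiE UNIV (\<lambda>i. {..<N i})"
    have "T \<beta> = (\<Sum>J\<in>?P. T (eval_form (\<lambda>i. pt i (J i))) * \<beta> (\<lambda>i. w i (J i)))"
      using T
    proof (induction rule: TP_induct)
      case (step c v T)
      have "pure v \<beta> = (\<Sum>J\<in>?P. pure v (eval_form (\<lambda>i. pt i (J i))) * \<beta> (\<lambda>i. w i (J i)))"
        using multilinear_expansion[OF True step(1) w dual finite_class.finite_UNIV] True
        by (simp add: pure_tensor_def multilinear_eval_form) (simp add: eval_form_def)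
      with step show ?case
        by (simp add: pointwise_def sum.distrib sum_distrib_left algebra_simps)
    qed simp
    then show ?thesis by (simp add: zero)
  qed (simp add: TP_not_multilinear[OF T])
qed

text \<open>A pure tensor first tests its argument for multilinearity, so \<open>\<beta>\<close> and
  its composition with \<open>g\<close> must give the same answer. The converse direction uses the
  inverse of \<open>g\<close>.\<close>

lemma tensor_action_pure:
  assumes g: "g \<in> SL3" and v: "on_V v"
  shows "tensor_action \<rho> g (pure v) = pure (\<lambda>i. \<rho> i g (v i))"
proof
  fix \<beta>
  have *: "multilinear (\<lambda>v. \<beta> (\<lambda>i. \<rho> i g (v i)))" if \<beta>: "multilinear \<beta>" and g: "g \<in> SL3" for \<beta> g
  proof -
    have "linear_on sc (*) (V i) (\<lambda>x. \<beta> (\<lambda>j. \<rho> j g ((v(i := x)) j)))" if v: "on_V v" for v i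
    proof -
      have upd: "(\<lambda>j. \<rho> j g ((v(i := x)) j)) = (\<lambda>j. \<rho> j g (v j))(i := \<rho> i g x)" for x
        by auto
      have "\<forall>j. \<rho> j g (v j) \<in> V j" using \<rho>_in[OF g] v by simp
      then have "linear_on sc (*) (V i) (\<lambda>x. \<beta> ((\<lambda>j. \<rho> j g (v j))(i := x)))"
        by (rule \<beta>[unfolded multilinear_form_def, THEN spec, THEN spec, THEN mp])
      then show ?thesis
        unfolding upd using \<rho>_linear[OF g, of i] \<rho>_in[OF g, of _ i] by (simp add: linear_on_def)
    qed
    then show ?thesis unfolding multilinear_form_def by simp
  qed
  have "multilinear \<beta>" if "multilinear (\<lambda>v. \<beta> (\<lambda>i. \<rho> i g (v i)))"
  proof -
    have "multilinear (\<lambda>v. \<beta> (\<lambda>i. \<rho> i g (\<rho> i (matrix_inv g) (v i))))"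
      using *[OF that SL3_inv[OF g]] .
    moreover have "\<beta> (\<lambda>i. \<rho> i g (\<rho> i (matrix_inv g) (v i))) = \<beta> v" if "on_V v" for v
      using \<rho>_inv_cancel[OF g] that by simp
    ultimately show ?thesis
      by (subst multilinear_cong[of \<beta> "\<lambda>v. \<beta> (\<lambda>i. \<rho> i g (\<rho> i (matrix_inv g) (v i)))"]) simp_all
  qed
  with *[OF _ g] show "tensor_action \<rho> g (pure v) \<beta> = pure (\<lambda>i. \<rho> i g (v i)) \<beta>"
    by (auto simp: tensor_action_def pure_tensor_def)
qed

lemma tensor_action_in_TP:
  assumes g: "g \<in> SL3" and "T \<in> TP"
  shows "tensor_action \<rho> g T \<in> TP"
  using assms(2)
proof (induction rule: TP_induct)
  case zero
  have "tensor_action \<rho> g (0 :: ('n, 'v) tensor) = 0" by (simp add: tensor_action_def fun_eq_iff)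
  then show "tensor_action \<rho> g 0 \<in> TP" by (simp only: fun_space.subspace_0[OF TP_subspace])
next
  case (step c v T)
  have "tensor_action \<rho> g (fscale c (pure v) + T)
      = fscale c (pure (\<lambda>i. \<rho> i g (v i))) + tensor_action \<rho> g T"
    unfolding tensor_action_pure[OF g step(1), symmetric]
    by (simp add: tensor_action_def pointwise_def fun_eq_iff)
  moreover have "pure (\<lambda>i. \<rho> i g (v i)) \<in> TP"
    using step \<rho>_in[OF g] by (intro pure_in_TP) blast
  ultimately show ?case
    using step fun_space.subspace_add[OF TP_subspace] fun_space.subspace_scale[OF TP_subspace] by metis
qed

lemma tensor_action_eval_form:
  assumes "g \<in> SL3" "T \<in> TP"
  shows "tensor_action \<rho> g T (eval_form z) = T (eval_form (\<lambda>i. pair_action (matrix_inv g) (z i)))"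
  unfolding tensor_action_def
  by (rule TP_cong[OF assms(2)]) (simp add: eval_form_def \<phi>_equivariant assms(1))

text \<open>Evaluation forms separate tensors, so invariance can be tested on the represented
  functions.\<close>

lemma tensor_invariant_iff:
  assumes T: "T \<in> TP"
  shows "T \<in> tensor_invariants sc V \<rho> \<longleftrightarrow>
    (\<forall>g\<in>SL3. \<forall>z. T (eval_form (\<lambda>i. pair_action g (z i))) = T (eval_form z))" (is "_ \<longleftrightarrow> ?R")
proof
  assume L: "T \<in> tensor_invariants sc V \<rho>"
  show ?R
  proof (intro ballI allI)
    fix g z assume g: "g \<in> SL3"
    have "tensor_action \<rho> (matrix_inv g) T = T"
      using L SL3_inv[OF g] by (simp add: tensor_invariants_def invariants_def)
    then show "T (eval_form (\<lambda>i. pair_action g (z i))) = T (eval_form z)"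
      using tensor_action_eval_form[OF SL3_inv[OF g] T] SL3_inv_inv[OF g] by simp
  qed
next
  assume R: ?R
  have "tensor_action \<rho> g T = T" if g: "g \<in> SL3" for g
  proof -
    have "tensor_action \<rho> g T - T = 0"
    proof (rule eval_forms_separate)
      show "tensor_action \<rho> g T - T \<in> TP"
        by (intro fun_space.subspace_diff[OF TP_subspace] tensor_action_in_TP g T)
      show "(tensor_action \<rho> g T - T) (eval_form z) = 0" for z
        using R SL3_inv[OF g] by (simp add: tensor_action_eval_form[OF g T])
    qed
    then show ?thesis by simp
  qed
  with T show "T \<in> tensor_invariants sc V \<rho>"
    by (simp add: tensor_invariants_def invariants_def)
qed

end

section \<open>Multihomogeneous decomposition\<close>

text \<open>Dedekind's argument: translating the relation by \<open>t\<close> and subtracting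
  \<open>ch d t\<close> times the original removes \<open>d\<close>. The choice of \<open>t\<close>
  multiplies the coefficient at the given \<open>e\<close> by a non-zero number.\<close>

lemma characters_independent:
  fixes ch :: "'e \<Rightarrow> 's \<Rightarrow> complex"
  assumes "finite F"
    and mult: "\<And>e s t. ch e (m s t) = ch e s * ch e t" and one: "\<And>e. ch e u = 1"
    and distinct: "\<And>e e'. e \<noteq> e' \<Longrightarrow> \<exists>s. ch e s \<noteq> ch e' s"
    and zero: "\<And>s. (\<Sum>e\<in>F. a e * ch e s) = 0" and "e \<in> F"
  shows "a e = 0"
  using assms(1) zero \<open>e \<in> F\<close>
proof (induction F arbitrary: a e)
  case (insert d F)
  have rest: "a e = 0" if e: "e \<in> F" for e
  proof -
    obtain t where t: "ch e t \<noteq> ch d t" using distinct[of e d] e insert.hyps by blast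
    have "(\<Sum>e\<in>F. (a e * (ch e t - ch d t)) * ch e s) = 0" for s
    proof -
      have "(\<Sum>e\<in>F. (a e * (ch e t - ch d t)) * ch e s)
          = (\<Sum>e\<in>insert d F. (a e * (ch e t - ch d t)) * ch e s)"
        using insert.hyps by simp
      also have "\<dots> = (\<Sum>e\<in>insert d F. a e * ch e (m s t)) - ch d t * (\<Sum>e\<in>insert d F. a e * ch e s)"
        unfolding mult sum_distrib_left sum_subtractf[symmetric]
        by (rule sum.cong) (simp_all add: algebra_simps)
      finally show ?thesis using insert.prems(1) by simp
    qed
    from insert.IH[OF this e] show ?thesis using t by simp
  qed
  have "a d = 0"
    using insert.prems(1)[of u] insert.hyps rest by (simp add: one)
  with rest insert.prems(2) show ?case by blast
qed simp

definition bichar :: "('n::finite \<Rightarrow> nat \<times> nat) \<Rightarrow> ('n \<Rightarrow> complex \<times> complex) \<Rightarrow> complex" where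
  "bichar e s = (\<Prod>i\<in>UNIV. fst (s i) ^ fst (e i) * snd (s i) ^ snd (e i))"

lemma bichar_single: "bichar e (\<lambda>j. if j = i then s else (1, 1)) = fst s ^ fst (e i) * snd s ^ snd (e i)"
proof -
  have "bichar e (\<lambda>j. if j = i then s else (1, 1))
      = (\<Prod>j\<in>UNIV. if j = i then fst s ^ fst (e i) * snd s ^ snd (e i) else 1)"
    unfolding bichar_def by (rule prod.cong) auto
  then show ?thesis by simp
qed

lemma two_power_inject: "(2 :: complex) ^ m = 2 ^ n \<longleftrightarrow> m = n"
proof
  assume "(2 :: complex) ^ m = 2 ^ n"
  then have "of_nat (2 ^ m) = (of_nat (2 ^ n) :: complex)" by simp
  then have "(2 :: nat) ^ m = 2 ^ n" by (simp only: of_nat_eq_iff)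
  then show "m = n" by simp
qed simp

text \<open>Different exponent families differ in some exponent; the scalar 2 there and 1 elsewhere
  separates the characters.\<close>

lemma bichar_independent:
  assumes "finite F" "\<And>s. (\<Sum>e\<in>F. a e * bichar e s) = 0" "e \<in> F"
  shows "a e = 0"
proof (rule characters_independent[where ch = bichar and m = "\<lambda>s t i. (fst (s i) * fst (t i), snd (s i) * snd (t i))"
    and u = "\<lambda>_. (1, 1)", OF assms(1) _ _ _ assms(2,3)])
  show "bichar e (\<lambda>i. (fst (s i) * fst (t i), snd (s i) * snd (t i))) = bichar e s * bichar e t" for e s t
    by (simp add: bichar_def power_mult_distrib prod.distrib mult_ac)
  show "bichar e (\<lambda>_. (1, 1)) = 1" for e by (simp add: bichar_def)
  show "\<exists>s. bichar e s \<noteq> bichar e' s" if ne: "e \<noteq> e'" for e e' :: "'a \<Rightarrow> nat \<times> nat"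
  proof -
    obtain i where "e i \<noteq> e' i" using ne by (auto simp: fun_eq_iff)
    then consider "fst (e i) \<noteq> fst (e' i)" | "snd (e i) \<noteq> snd (e' i)" by (auto simp: prod_eq_iff)
    then show ?thesis
    proof cases
      case 1
      then show ?thesis
        by (intro exI[of _ "\<lambda>j. if j = i then (2, 1) else (1, 1)"])
          (simp add: bichar_single two_power_inject)
    next
      case 2
      then show ?thesis
        by (intro exI[of _ "\<lambda>j. if j = i then (1, 2) else (1, 1)"])
          (simp add: bichar_single two_power_inject)
    qed
  qed
qed

section \<open>Monomials and scaling on n pairs\<close>

definition scale_all :: "('n \<Rightarrow> complex \<times> complex) \<Rightarrow> vec_covec^'n \<Rightarrow> vec_covec^'n" where
  "scale_all s z = (\<chi> i. pair_scale (s i) (z $ i))"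

lemma scale_all_Mvar: "z \<in> Mvar \<Longrightarrow> scale_all s z \<in> Mvar"
  by (simp add: Mvar_def scale_all_def pair_scale_incidence)

lemma group_action_Mvar: "g \<in> SL3 \<Longrightarrow> z \<in> Mvar \<Longrightarrow> group_action g z \<in> Mvar"
  by (simp add: Mvar_def group_action_def pair_action_incidence)

lemma torus_action_scale: "torus_action t z = scale_all (\<lambda>i. (inverse (t i), t i)) z"
  by (simp add: torus_action_def scale_all_def pair_scale_def)

lemma group_action_scale: "group_action g (scale_all s z) = scale_all s (group_action g z)"
  by (simp add: group_action_def scale_all_def pair_scale_def pair_action_def vec_eq_iff
    matrix_vector_mult_def vector_matrix_mult_def sum_distrib_left mult_ac)

definition monomial :: "('n::finite \<Rightarrow> 3 list \<times> 3 list) \<Rightarrow> vec_covec^'n \<Rightarrow> complex" where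
  "monomial W z = (\<Prod>i\<in>UNIV. pair_monomial (W i) (z $ i))"

lemma monomial_scale: "monomial W (scale_all s z) = bichar (\<lambda>i. bidegree (W i)) s * monomial W z"
  by (simp add: monomial_def scale_all_def pair_monomial_scale bichar_def prod.distrib)

lemma monomial_mult:
  "monomial W z * monomial W' z = monomial (\<lambda>i. (fst (W i) @ fst (W' i), snd (W i) @ snd (W' i))) z"
  by (simp add: monomial_def pair_monomial_def word_monomial_def prod.distrib mult_ac)

lemma span_range_monomial_mult:
  assumes f: "f \<in> fspan (range monomial)" and g: "g \<in> fspan (range monomial)"
  shows "(\<lambda>z. f z * g z) \<in> fspan (range monomial)"
  using f
proof (induction rule: fun_space.span_induct_alt)
  case base
  have "(\<lambda>z. 0 z * g z) = 0" by (simp add: fun_eq_iff)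
  then show ?case by (metis fun_space.span_zero)
next
  case (step c x y)
  then obtain W where W: "x = monomial W" by blast
  have "(\<lambda>z. monomial W z * g z) \<in> fspan (range monomial)"
    using g
  proof (induction rule: fun_space.span_induct_alt)
    case base
    have "(\<lambda>z. monomial W z * 0 z) = 0" by (simp add: fun_eq_iff)
    then show ?case by (metis fun_space.span_zero)
  next
    case (step d x' y')
    then obtain W' where W': "x' = monomial W'" by blast
    have "(\<lambda>z. monomial W z * (fscale d x' + y') z) =
        fscale d (monomial (\<lambda>i. (fst (W i) @ fst (W' i), snd (W i) @ snd (W' i))))
        + (\<lambda>z. monomial W z * y' z)"
      unfolding W' by (simp add: fun_eq_iff pointwise_def algebra_simps flip: monomial_mult)
    moreover have "\<dots> \<in> fspan (range monomial)"
      using step by (intro fun_space.span_add fun_space.span_scale) (auto intro: fun_space.span_base)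
    ultimately show ?case by metis
  qed
  from fun_space.span_add[OF fun_space.span_scale[OF this, of c] step(2)]
  have "fscale c (\<lambda>z. monomial W z * g z) + (\<lambda>z. y z * g z) \<in> fspan (range monomial)" .
  also have "fscale c (\<lambda>z. monomial W z * g z) + (\<lambda>z. y z * g z) = (\<lambda>z. (fscale c x + y) z * g z)"
    unfolding W by (simp add: fun_eq_iff pointwise_def algebra_simps)
  finally show ?case .
qed

lemma poly_funs_in_span_monomial:
  assumes "p \<in> poly_funs (Mvar_coords :: (vec_covec^'n::finite \<Rightarrow> complex) set)"
  shows "p \<in> fspan (range monomial)"
  using assms
proof induction
  case (const c)
  have "(\<lambda>_. c) = fscale c (monomial (\<lambda>_. ([], [])))"
    by (simp add: fun_eq_iff monomial_def pair_monomial_def word_monomial_def pointwise_def)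
  then show ?case by (metis fun_space.span_base fun_space.span_scale rangeI)
next
  case (coord f)
  have single: "(\<lambda>z. pair_monomial w (z $ i)) \<in> fspan (range monomial)" for w and i :: 'n
  proof -
    have "monomial (\<lambda>j. if j = i then w else ([], [])) z = pair_monomial w (z $ i)" for z
    proof -
      have "monomial (\<lambda>j. if j = i then w else ([], [])) z
          = (\<Prod>j\<in>UNIV. if j = i then pair_monomial w (z $ i) else 1)"
        unfolding monomial_def by (rule prod.cong) (auto simp: pair_monomial_def word_monomial_def)
      then show ?thesis by simp
    qed
    then have "(\<lambda>z. pair_monomial w (z $ i)) = monomial (\<lambda>j. if j = i then w else ([], []))"
      by (simp add: fun_eq_iff)
    then show ?thesis by (metis fun_space.span_base rangeI)
  qed
  have "(\<lambda>z. fst (z $ i) $ k) \<in> fspan (range monomial)"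
    "(\<lambda>z. snd (z $ i) $ k) \<in> fspan (range monomial)" for i :: 'n and k
    using single[of "([], [k])" i] single[of "([k], [])" i]
    by (simp_all add: pair_monomial_def word_monomial_def)
  with coord show ?case
    unfolding Mvar_coords_def pair_coords_def by blast
next
  case (add f g)
  then show ?case using fun_space.span_add[of f _ g] by (simp add: plus_fun_def)
next
  case (mult f g)
  then show ?case by (intro span_range_monomial_mult)
qed

text \<open>Monomials of equal multidegree are collected. The components are polynomials on the
  ambient space and hence scale by their character at every point.\<close>

lemma multihomogeneous_decomposition:
  fixes p :: "vec_covec^'n::finite \<Rightarrow> complex"
  assumes "p \<in> poly_funs Mvar_coords"
  obtains F h where "finite F" "\<And>e. h e \<in> fspan {monomial W | W. (\<lambda>i. bidegree (W i)) = e}"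
    "\<And>z. p z = (\<Sum>e\<in>F. h e z)"
proof -
  let ?S = "\<lambda>e. fspan {monomial W | W :: 'n \<Rightarrow> _. (\<lambda>i. bidegree (W i)) = e}"
  \<comment> \<open>Vanishing outside \<open>F\<close> is carried along so that a monomial can be
    added at its multidegree whether or not that is already in \<open>F\<close>.\<close>
  have "\<exists>F h. finite F \<and> (\<forall>e. h e \<in> ?S e) \<and> (\<forall>e. e \<notin> F \<longrightarrow> h e = 0) \<and> p = (\<Sum>e\<in>F. h e)"
    using poly_funs_in_span_monomial[OF assms]
  proof (induction rule: fun_space.span_induct_alt)
    case base
    show ?case
      by (rule exI[of _ "{}"], rule exI[of _ "\<lambda>_. 0"])
        (intro conjI allI impI refl fun_space.span_zero finite.emptyI, simp)
  next
    case (step c x y)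
    then obtain F h where F: "finite F" and h: "\<And>e. h e \<in> ?S e" "\<And>e. e \<notin> F \<Longrightarrow> h e = 0"
      and y: "y = (\<Sum>e\<in>F. h e)" by blast
    obtain W where W: "x = monomial W" using step by blast
    define d where "d = (\<lambda>i. bidegree (W i))"
    define h' where "h' = (\<lambda>e. h e + (if e = d then fscale c x else 0))"
    have "fscale c x \<in> ?S d"
      unfolding W d_def by (intro fun_space.span_scale fun_space.span_base) blast
    then have "h' e \<in> ?S e" for e
      unfolding h'_def using h(1)[of e] by (cases "e = d") (simp_all add: fun_space.span_add)
    moreover have "h' e = 0" if "e \<notin> insert d F" for e
      using that h(2) by (simp add: h'_def)
    moreover have "(\<Sum>e\<in>insert d F. h' e) = fscale c x + y"
    proof -
      have "(\<Sum>e\<in>insert d F. h e) = y"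
        unfolding y using F h(2) by (intro sum.mono_neutral_right) auto
      moreover have "(\<Sum>e\<in>insert d F. if e = d then fscale c x else 0) = fscale c x"
        using F by simp
      ultimately show ?thesis
        unfolding h'_def sum.distrib by (simp only: add.commute)
    qed
    ultimately show ?case
      using F by (intro exI[of _ "insert d F"] exI[of _ h']) simp
  qed
  then obtain F h where "finite F" "\<And>e. h e \<in> ?S e" "p = (\<Sum>e\<in>F. h e)" by blast
  then show thesis using that[of F h] by (simp add: sum_fun_apply)
qed

lemma span_monomial_scale:
  assumes "h \<in> fspan {monomial W | W. (\<lambda>i. bidegree (W i)) = e}"
  shows "h (scale_all s z) = bichar e s * h z"
  using assms
proof (induction rule: fun_space.span_induct_alt)
  case (step c x y)
  then have "x (scale_all s z) = bichar e s * x z" by (auto simp: monomial_scale)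
  with step show ?case by (simp add: pointwise_def algebra_simps)
qed simp

lemma Wspace_subspace: "module.subspace fscale (Wspace :: (vec_covec^'n::finite \<Rightarrow> complex) set)"
proof (rule fun_space.subspaceI)
  show "0 \<in> (Wspace :: (vec_covec^'n \<Rightarrow> complex) set)"
    using fun_space.subspace_0[OF coordinate_ring_subspace] unfolding Wspace_def by simp
next
  fix f g :: "vec_covec^'n \<Rightarrow> complex" assume fg: "f \<in> Wspace" "g \<in> Wspace"
  then have "f + g \<in> coordinate_ring Mvar_coords Mvar"
    unfolding Wspace_def by (intro fun_space.subspace_add[OF coordinate_ring_subspace]) blast+
  with fg show "f + g \<in> Wspace" by (simp add: Wspace_def algebra_simps)
next
  fix c and f :: "vec_covec^'n \<Rightarrow> complex" assume f: "f \<in> Wspace"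
  then have "fscale c f \<in> coordinate_ring Mvar_coords Mvar"
    unfolding Wspace_def by (intro fun_space.subspace_scale[OF coordinate_ring_subspace]) blast
  with f show "fscale c f \<in> Wspace" by (simp add: Wspace_def pointwise_def)
qed

section \<open>From tensors to multihomogeneous functions\<close>

locale embedded_family = vector_space sc
  for sc :: "complex \<Rightarrow> 'v::ab_group_add \<Rightarrow> 'v" +
  fixes V :: "nat \<Rightarrow> 'v set" and \<rho> :: "nat \<Rightarrow> complex^3^3 \<Rightarrow> 'v \<Rightarrow> 'v"
    and \<phi> :: "nat \<Rightarrow> 'v \<Rightarrow> vec_covec \<Rightarrow> complex"
  assumes rep: "\<And>k. SL3_representation sc (V k) (\<rho> k)"
    and embed: "\<And>k. equivariant_embedding sc (V k) (\<rho> k) (\<phi> k)"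
    and image_embed: "\<And>k. \<phi> k ` V k = fspan {flag_kernel (k + 3) k (pair_action h base_flag) | h. h \<in> SL3}"
begin

lemma slots: "tensor_setup sc (\<lambda>i::'n::finite. V (r i)) (\<lambda>i. \<rho> (r i)) (\<lambda>i. \<phi> (r i))"
  by unfold_locales (rule rep embed)+

abbreviation "TP r \<equiv> tensor_product sc (\<lambda>i. V (r i))"
abbreviation "TI r \<equiv> tensor_invariants sc (\<lambda>i. V (r i)) (\<lambda>i. \<rho> (r i))"
abbreviation "pure r \<equiv> pure_tensor sc (\<lambda>i. V (r i))"

text \<open>The multiplication map: a pure tensor becomes the product of its embedded vectors, each
  evaluated at its own pair.\<close>

definition Psi :: "('n::finite \<Rightarrow> nat) \<Rightarrow> ('n, 'v) tensor \<Rightarrow> vec_covec^'n \<Rightarrow> complex" where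
  "Psi r T = (\<lambda>z. T (tensor_setup.eval_form (\<lambda>i. \<phi> (r i)) (($) z)))"

lemma TI_sub: "TI r \<subseteq> TP r"
  by (auto simp: tensor_invariants_def invariants_def)

lemma TI_subspace: "module.subspace fscale (TI r)"
proof (rule fun_space.subspaceI)
  note sub = tensor_setup.TP_subspace[OF slots, of r]
  have add: "tensor_action (\<lambda>i. \<rho> (r i)) g (S + T)
      = tensor_action (\<lambda>i. \<rho> (r i)) g S + tensor_action (\<lambda>i. \<rho> (r i)) g T" for g S T
    by (simp add: tensor_action_def fun_eq_iff)
  have scale: "tensor_action (\<lambda>i. \<rho> (r i)) g (fscale c T) = fscale c (tensor_action (\<lambda>i. \<rho> (r i)) g T)"
    for g c T
    by (simp add: tensor_action_def fun_eq_iff pointwise_def)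
  show "0 \<in> TI r"
    using fun_space.subspace_0[OF sub]
    by (simp add: tensor_invariants_def invariants_def tensor_action_def fun_eq_iff)
  show "S + T \<in> TI r" if "S \<in> TI r" "T \<in> TI r" for S T
    using that fun_space.subspace_add[OF sub] by (simp add: tensor_invariants_def invariants_def add)
  show "fscale c T \<in> TI r" if "T \<in> TI r" for c T
    using that fun_space.subspace_scale[OF sub] by (simp add: tensor_invariants_def invariants_def scale)
qed

lemma Psi_linear:
  "Psi r (S + T) = Psi r S + Psi r T" "Psi r (fscale c T) = fscale c (Psi r T)" "Psi r 0 = 0"
  by (simp_all add: Psi_def pointwise_def fun_eq_iff)

lemma Psi_pure: "Psi r (pure r v) = (\<lambda>z. \<Prod>i\<in>UNIV. \<phi> (r i) (v i) (z $ i))"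
  using tensor_setup.multilinear_eval_form[OF slots, of r]
  by (simp add: Psi_def pure_tensor_def tensor_setup.eval_form_def[OF slots])

lemma Psi_injective:
  assumes "T \<in> TP r" "Psi r T = 0"
  shows "T = 0"
proof (rule tensor_setup.eval_forms_separate[OF slots assms(1)])
  fix z
  show "T (tensor_setup.eval_form (\<lambda>i. \<phi> (r i)) z) = 0"
    using fun_cong[OF assms(2), of "\<chi> i. z i"] by (simp add: Psi_def vec_lambda_inverse)
qed

lemma \<phi>_in_span:
  "x \<in> V k \<Longrightarrow> \<phi> k x \<in> fspan {flag_kernel (k + 3) k (pair_action h base_flag) | h. h \<in> SL3}"
  using image_embed by blast

lemma Psi_coordinate_ring:
  assumes "T \<in> TP r"
  shows "Psi r T \<in> coordinate_ring Mvar_coords Mvar"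
  using assms
proof (induction rule: tensor_setup.TP_induct[OF slots, consumes 1, case_names zero step])
  case zero
  show "Psi r 0 \<in> coordinate_ring Mvar_coords Mvar"
    unfolding Psi_linear by (rule fun_space.subspace_0[OF coordinate_ring_subspace])
next
  case (step c v T)
  have "\<phi> (r i) (v i) \<in> coordinate_ring pair_coords incidence" for i
    using embed[of "r i"] step(1) unfolding equivariant_embedding_def by blast
  then have "\<forall>i. \<exists>p. p \<in> poly_funs pair_coords \<and> (\<forall>z\<in>incidence. \<phi> (r i) (v i) z = p z) \<and>
    (\<forall>z. z \<notin> incidence \<longrightarrow> \<phi> (r i) (v i) z = 0)"
    unfolding coordinate_ring_def by blast
  then obtain p where p: "\<And>i. p i \<in> poly_funs pair_coords"
    "\<And>i z. z \<in> incidence \<Longrightarrow> \<phi> (r i) (v i) z = p i z"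
    "\<And>i z. z \<notin> incidence \<Longrightarrow> \<phi> (r i) (v i) z = 0"
    unfolding choice_iff by blast
  have "Psi r (pure r v) \<in> coordinate_ring Mvar_coords Mvar"
    unfolding coordinate_ring_def mem_Collect_eq
  proof (intro conjI bexI[of _ "\<lambda>z. \<Prod>i\<in>UNIV. p i (z $ i)"] ballI allI impI)
    show "Psi r (pure r v) z = (\<Prod>i\<in>UNIV. p i (z $ i))" if "z \<in> Mvar" for z
      using that p(2) by (simp add: Psi_pure Mvar_def)
    show "(\<lambda>z. \<Prod>i\<in>UNIV. p i (z $ i)) \<in> poly_funs Mvar_coords"
      by (intro poly_funs_prod poly_funs_comp[OF p(1)] poly_funs.coord) (auto simp: Mvar_coords_def)
    show "Psi r (pure r v) z = 0" if "z \<notin> Mvar" for z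
    proof -
      obtain i where "z $ i \<notin> incidence" using \<open>z \<notin> Mvar\<close> by (auto simp: Mvar_def)
      then have "\<phi> (r i) (v i) (z $ i) = 0" by (rule p(3))
      then show ?thesis by (auto simp: Psi_pure prod_zero_iff)
    qed
  qed
  then show "Psi r (fscale c (pure r v) + T) \<in> coordinate_ring Mvar_coords Mvar"
    unfolding Psi_linear using step(3)
    by (intro fun_space.subspace_add[OF coordinate_ring_subspace]
      fun_space.subspace_scale[OF coordinate_ring_subspace])
qed

lemma Psi_scale:
  assumes "T \<in> TP r" "z \<in> Mvar"
  shows "Psi r T (scale_all s z) = bichar (\<lambda>i. (r i + 3, r i)) s * Psi r T z"
  using assms(1)
proof (induction rule: tensor_setup.TP_induct[OF slots, consumes 1, case_names zero step])
  case zero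
  show "Psi r 0 (scale_all s z) = bichar (\<lambda>i. (r i + 3, r i)) s * Psi r 0 z"
    by (simp add: Psi_linear)
next
  case (step c v T)
  have "\<phi> (r i) (v i) (pair_scale (s i) (z $ i))
      = fst (s i) ^ (r i + 3) * snd (s i) ^ r i * \<phi> (r i) (v i) (z $ i)" for i
    using step(1) assms(2) by (intro span_flag_kernel_scale \<phi>_in_span) (auto simp: Mvar_def)
  then have "Psi r (pure r v) (scale_all s z) = bichar (\<lambda>i. (r i + 3, r i)) s * Psi r (pure r v) z"
    by (simp add: Psi_pure scale_all_def bichar_def prod.distrib)
  with step(3) show "Psi r (fscale c (pure r v) + T) (scale_all s z)
    = bichar (\<lambda>i. (r i + 3, r i)) s * Psi r (fscale c (pure r v) + T) z"
    unfolding Psi_linear by (simp add: pointwise_def algebra_simps)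
qed

lemma Psi_in_Wspace:
  assumes T: "T \<in> TI r"
  shows "Psi r T \<in> Wspace"
proof -
  have TP: "T \<in> TP r" using T TI_sub by blast
  have "Psi r T (group_action g z) = Psi r T z" if "g \<in> SL3" for g z
  proof -
    have "($) (group_action g z) = (\<lambda>i. pair_action g (z $ i))"
      by (simp add: group_action_def fun_eq_iff)
    then show ?thesis
      using T that unfolding tensor_setup.tensor_invariant_iff[OF slots TP] by (simp add: Psi_def)
  qed
  moreover have "Psi r T (torus_action t z) = (\<Prod>i\<in>UNIV. t i) powi (-3) * Psi r T z"
    if t: "\<forall>i. t i \<noteq> 0" and z: "z \<in> Mvar" for t z
  proof -
    \<comment> \<open>The covector enters with degree \<open>r i + 3\<close> and is scaled by the
      inverse of \<open>t i\<close>, the vector with degree \<open>r i\<close> and is scaled by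
      \<open>t i\<close>; the dependence on \<open>r i\<close> cancels.\<close>
    have "inverse (t i) ^ (r i + 3) * t i ^ r i = inverse (t i) ^ 3" for i
      using t by (simp add: power_add power_inverse)
    then have "bichar (\<lambda>i. (r i + 3, r i)) (\<lambda>i. (inverse (t i), t i)) = (\<Prod>i\<in>UNIV. inverse (t i) ^ 3)"
      by (simp add: bichar_def)
    also have "\<dots> = (\<Prod>i\<in>UNIV. t i) powi (-3)"
      by (simp add: power_int_def prod_power_distrib prod_inversef[symmetric] power_inverse)
    finally show ?thesis unfolding torus_action_scale Psi_scale[OF TP z] by simp
  qed
  ultimately show ?thesis using Psi_coordinate_ring[OF TP] unfolding Wspace_def by blast
qed

text \<open>Each factor of such a monomial is, on the cone, the image of a vector, because the
  embedding fills its bihomogeneous component. The tensor of these vectors represents the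
  monomial.\<close>

lemma Psi_surjective:
  assumes "h \<in> fspan {monomial W | W. (\<lambda>i. bidegree (W i)) = (\<lambda>i. (r i + 3, r i))}"
  shows "\<exists>T\<in>TP r. \<forall>z\<in>Mvar. Psi r T z = h z"
  using assms
proof (induction rule: fun_space.span_induct_alt)
  case base
  have "0 \<in> TP r" by (rule fun_space.subspace_0[OF tensor_setup.TP_subspace[OF slots]])
  then show "\<exists>T\<in>TP r. \<forall>z\<in>Mvar. Psi r T z = 0 z"
    by (intro bexI[of _ 0]) (simp_all add: Psi_linear)
next
  case (step c x y)
  then obtain T where T: "T \<in> TP r" "\<forall>z\<in>Mvar. Psi r T z = y z" by blast
  obtain W where W: "x = monomial W" "(\<lambda>i. bidegree (W i)) = (\<lambda>i. (r i + 3, r i))"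
    using step by blast
  have "\<forall>i. \<exists>u. u \<in> V (r i) \<and> \<phi> (r i) u = (\<lambda>z. if z \<in> incidence then pair_monomial (W i) z else 0)"
  proof
    fix i
    have "bidegree (W i) = (r i + 3, r i)" using fun_cong[OF W(2), of i] .
    then have "(\<lambda>z. if z \<in> incidence then pair_monomial (W i) z else 0) \<in> \<phi> (r i) ` V (r i)"
      unfolding image_embed by (rule pair_monomial_in_span)
    then show "\<exists>u. u \<in> V (r i) \<and> \<phi> (r i) u = (\<lambda>z. if z \<in> incidence then pair_monomial (W i) z else 0)"
      by (elim imageE) (rule exI, erule conjI, erule sym)
  qed
  then obtain v where v: "\<And>i. v i \<in> V (r i)"
    "\<And>i. \<phi> (r i) (v i) = (\<lambda>z. if z \<in> incidence then pair_monomial (W i) z else 0)"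
    unfolding choice_iff by blast
  have "Psi r (pure r v) z = x z" if "z \<in> Mvar" for z
    using that unfolding Psi_pure v(2) W(1) monomial_def by (simp add: Mvar_def)
  then have "Psi r (fscale c (pure r v) + T) z = (fscale c x + y) z" if "z \<in> Mvar" for z
    using that T unfolding Psi_linear by (simp add: pointwise_def)
  moreover have "fscale c (pure r v) + T \<in> TP r"
    using T v(1) tensor_setup.TP_subspace[OF slots, of r] tensor_setup.pure_in_TP[OF slots, of v r]
    by (intro fun_space.subspace_add fun_space.subspace_scale) auto
  ultimately show ?case by blast
qed

section \<open>The isomorphism on the direct sum\<close>

definition Phi :: "(('n::finite \<Rightarrow> nat) \<Rightarrow> ('n, 'v) tensor) \<Rightarrow> vec_covec^'n \<Rightarrow> complex" where
  "Phi x = (\<Sum>r | x r \<noteq> 0. Psi r (x r))"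

lemma Phi_superset:
  assumes "finite R" "{r. x r \<noteq> 0} \<subseteq> R"
  shows "Phi x = (\<Sum>r\<in>R. Psi r (x r))"
  unfolding Phi_def using assms by (intro sum.mono_neutral_left) (auto simp: Psi_linear)

lemma Phi_single: "Phi (0(r := T)) = Psi r T"
  by (subst Phi_superset[of "{r}"]) auto

lemma Phi_linear: "linear_on (pointwise fscale) fscale (direct_sum (TI :: ('n::finite \<Rightarrow> nat) \<Rightarrow> _)) Phi"
  unfolding linear_on_def
proof (intro conjI ballI allI)
  fix x y :: "('n \<Rightarrow> nat) \<Rightarrow> ('n, 'v) tensor"
  assume "x \<in> direct_sum TI" "y \<in> direct_sum TI"
  then have fin: "finite ({r. x r \<noteq> 0} \<union> {r. y r \<noteq> 0})" by (simp add: direct_sum_def)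
  have "Phi (x + y) = (\<Sum>r\<in>{r. x r \<noteq> 0} \<union> {r. y r \<noteq> 0}. Psi r ((x + y) r))"
    by (rule Phi_superset[OF fin]) auto
  also have "\<dots> = Phi x + Phi y"
    unfolding Phi_superset[OF fin Un_upper1] Phi_superset[OF fin Un_upper2]
    by (simp add: Psi_linear sum.distrib)
  finally show "Phi (x + y) = Phi x + Phi y" .
next
  fix c and x :: "('n \<Rightarrow> nat) \<Rightarrow> ('n, 'v) tensor"
  assume "x \<in> direct_sum TI"
  then have fin: "finite {r. x r \<noteq> 0}" by (simp add: direct_sum_def)
  have "Phi (pointwise fscale c x) = (\<Sum>r | x r \<noteq> 0. Psi r (fscale c (x r)))"
    by (subst Phi_superset[OF fin]) (auto simp: pointwise_def fun_eq_iff)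
  also have "\<dots> = fscale c (Phi x)"
    unfolding Phi_def Psi_linear fun_space.scale_sum_right ..
  finally show "Phi (pointwise fscale c x) = fscale c (Phi x)" .
qed

lemma Phi_in_Wspace: "x \<in> direct_sum TI \<Longrightarrow> Phi x \<in> Wspace"
  unfolding Phi_def
  by (intro fun_space.subspace_sum[OF Wspace_subspace] Psi_in_Wspace) (simp add: direct_sum_def)

text \<open>Different \<open>r\<close> have different multidegrees, so independence of characters
  under rescaling isolates each summand of \<open>Phi x\<close>, and \<open>Psi r\<close> is
  injective on tensors.\<close>

lemma Phi_injective:
  fixes x :: "('n::finite \<Rightarrow> nat) \<Rightarrow> ('n, 'v) tensor"
  assumes x: "x \<in> direct_sum TI" and zero: "Phi x = 0"
  shows "x = 0"
proof (rule ccontr)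
  assume "x \<noteq> 0"
  then obtain r where r: "x r \<noteq> 0" by (auto simp: fun_eq_iff)
  define F where "F = {r. x r \<noteq> 0}"
  have fin: "finite F" using x by (simp add: direct_sum_def F_def)
  have TP: "x r \<in> TP r" for r using x TI_sub by (auto simp: direct_sum_def)
  define e where "e = (\<lambda>(r :: 'n \<Rightarrow> nat) i. (r i + 3, r i))"
  have inj: "inj_on e F" by (auto simp: inj_on_def e_def fun_eq_iff)
  have "Psi r (x r) z = 0" for z
  proof (cases "z \<in> Mvar")
    case True
    have "(\<Sum>d\<in>e ` F. Psi (inv_into F e d) (x (inv_into F e d)) z * bichar d s) = 0" for s
    proof -
      have "(\<Sum>d\<in>e ` F. Psi (inv_into F e d) (x (inv_into F e d)) z * bichar d s)
          = (\<Sum>r\<in>F. Psi r (x r) z * bichar (e r) s)"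
        unfolding sum.reindex[OF inj] by (rule sum.cong) (simp_all add: inj)
      also have "\<dots> = (\<Sum>r\<in>F. Psi r (x r) (scale_all s z))"
        using Psi_scale[OF TP True] by (simp add: e_def mult.commute)
      also have "\<dots> = Phi x (scale_all s z)"
        by (simp add: Phi_def F_def sum_fun_apply)
      finally show ?thesis by (simp add: zero)
    qed
    from bichar_independent[OF _ this, of "e r"] show ?thesis
      using fin r inj by (simp add: F_def)
  next
    case False
    then show ?thesis using Psi_coordinate_ring[OF TP[of r]] by (simp add: coordinate_ring_def)
  qed
  then have "x r = 0" by (intro Psi_injective[OF TP]) (simp add: fun_eq_iff)
  with r show False ..
qed

text \<open>Take the multihomogeneous components of a polynomial representing \<open>H\<close>. On
  the variety each is invariant, and those not of bidegree \<open>(r i + 3, r i)\<close> in every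
  slot vanish; the remaining ones come from tensors.\<close>

lemma Phi_surjective:
  fixes H :: "vec_covec^'n::finite \<Rightarrow> complex"
  assumes H: "H \<in> Wspace"
  obtains x where "x \<in> direct_sum TI" "Phi x = H"
proof -
  obtain p where p: "p \<in> poly_funs Mvar_coords" and Hp: "\<And>z. z \<in> Mvar \<Longrightarrow> H z = p z"
    and H0: "\<And>z. z \<notin> Mvar \<Longrightarrow> H z = 0"
    using H unfolding Wspace_def coordinate_ring_def by blast
  obtain F h where F: "finite F"
    and h: "\<And>e. h e \<in> fspan {monomial W | W :: 'n \<Rightarrow> _. (\<lambda>i. bidegree (W i)) = e}"
    and ph: "\<And>z. p z = (\<Sum>e\<in>F. h e z)"
    using multihomogeneous_decomposition[OF p] by blast
  note scale = span_monomial_scale[OF h]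
  have Hs: "H (scale_all s z) = (\<Sum>e\<in>F. h e z * bichar e s)" if "z \<in> Mvar" for s z
    using Hp[OF scale_all_Mvar[OF that]] by (simp add: ph scale mult.commute)
  \<comment> \<open>Scaling commutes with the group, so the invariance of \<open>H\<close> at
    rescaled points can be compared character by character.\<close>
  have invariant: "h e (group_action g z) = h e z" if g: "g \<in> SL3" and z: "z \<in> Mvar" and e: "e \<in> F" for g z e
  proof -
    have "(\<Sum>e\<in>F. (h e (group_action g z) - h e z) * bichar e s) = 0" for s
    proof -
      have "H (group_action g (scale_all s z)) = H (scale_all s z)"
        using H g scale_all_Mvar[OF z] by (simp add: Wspace_def)
      then show ?thesis
        unfolding group_action_scale Hs[OF group_action_Mvar[OF g z]] Hs[OF z]
        by (simp add: left_diff_distrib sum_subtractf)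
    qed
    from bichar_independent[OF F this e] show ?thesis by simp
  qed
  have vanish: "h e z = 0" if z: "z \<in> Mvar" and e: "e \<in> F" and i: "fst (e i) \<noteq> snd (e i) + 3" for z e i
  proof -
    \<comment> \<open>Scaling slot \<open>i\<close> alone by 2 multiplies the component by 2 to the
      power \<open>snd (e i) - fst (e i)\<close> and \<open>H\<close> by 2 to the power -3; these
      differ.\<close>
    define t :: "'n \<Rightarrow> complex" where "t = (\<lambda>j. if j = i then 2 else 1)"
    define c where "c = (\<Prod>j\<in>UNIV. t j) powi (-3)"
    define u where "u = (\<lambda>j. (inverse (t j), t j))"
    have "(\<Sum>e\<in>F. ((bichar e u - c) * h e z) * bichar e s) = 0" for s
    proof -
      have "H (scale_all u (scale_all s z)) = c * H (scale_all s z)"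
        using H scale_all_Mvar[OF z] unfolding u_def c_def torus_action_scale[symmetric]
        by (simp add: Wspace_def t_def)
      then have "(\<Sum>e\<in>F. h e (scale_all s z) * bichar e u) = c * (\<Sum>e\<in>F. h e z * bichar e s)"
        unfolding Hs[OF z] Hs[OF scale_all_Mvar[OF z]] .
      then show ?thesis
        by (simp add: scale sum_distrib_left sum_subtractf algebra_simps)
    qed
    from bichar_independent[OF F this e] have "bichar e u = c \<or> h e z = 0" by simp
    moreover have "bichar e u \<noteq> c"
    proof
      assume eq: "bichar e u = c"
      have "u = (\<lambda>j. if j = i then (inverse 2, 2) else (1, 1))"
        by (auto simp: u_def t_def)
      then have "bichar e u = inverse 2 ^ fst (e i) * 2 ^ snd (e i)"
        by (simp add: bichar_single)
      moreover have "c = inverse 2 ^ 3"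
        by (simp add: c_def t_def power_int_def)
      ultimately have "(2 :: complex) ^ (snd (e i) + 3) = 2 ^ fst (e i)"
        using eq by (simp add: field_simps power_add)
      with i show False by (simp only: two_power_inject)
    qed
    ultimately show ?thesis by blast
  qed
  define d where "d = (\<lambda>(r :: 'n \<Rightarrow> nat) i. (r i + 3, r i))"
  have d_inj: "inj d" by (auto simp: inj_def d_def fun_eq_iff)
  define R where "R = {r. d r \<in> F}"
  have R: "finite R" unfolding R_def using finite_vimageI[OF F d_inj] by (simp add: vimage_def)
  have "\<exists>T\<in>TP r. \<forall>z\<in>Mvar. Psi r T z = h (d r) z" for r
    using h[of "d r"] unfolding d_def by (rule Psi_surjective)
  then obtain T where T: "\<And>r. T r \<in> TP r" "\<And>r z. z \<in> Mvar \<Longrightarrow> Psi r (T r) z = h (d r) z"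
    by metis
  have T0: "Psi r (T r) z = 0" if "z \<notin> Mvar" for r z
    using Psi_coordinate_ring[OF T(1)] that by (simp add: coordinate_ring_def)
  have TI: "T r \<in> TI r" if "r \<in> R" for r
    unfolding tensor_setup.tensor_invariant_iff[OF slots T(1)]
  proof (intro ballI allI)
    fix g and z :: "'n \<Rightarrow> vec_covec" assume g: "g \<in> SL3"
    let ?z = "\<chi> i. z i"
    have "Psi r (T r) (group_action g ?z) = Psi r (T r) ?z"
    proof (cases "?z \<in> Mvar")
      case True
      then show ?thesis
        using T(2) group_action_Mvar[OF g True] invariant[OF g True, of "d r"] that by (simp add: R_def)
    next
      case False
      then have "group_action g ?z \<notin> Mvar"
        using g by (simp add: Mvar_def group_action_def pair_action_incidence)
      with False show ?thesis by (simp add: T0)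
    qed
    moreover have "($) (group_action g ?z) = (\<lambda>i. pair_action g (z i))" "($) ?z = z"
      by (simp_all add: group_action_def fun_eq_iff)
    ultimately show "T r (tensor_setup.eval_form (\<lambda>i. \<phi> (r i)) (\<lambda>i. pair_action g (z i)))
        = T r (tensor_setup.eval_form (\<lambda>i. \<phi> (r i)) z)"
      by (simp add: Psi_def)
  qed
  \<comment> \<open>A component with multidegree outside \<open>F\<close> does not occur in
    \<open>p\<close> and is not known to be invariant, hence the value 0 outside
    \<open>R\<close>.\<close>
  define x where "x = (\<lambda>r. if r \<in> R then T r else 0)"
  have sub: "{r. x r \<noteq> 0} \<subseteq> R" by (auto simp: x_def)
  have "0 \<in> TI r" for r :: "'n \<Rightarrow> nat"
    by (rule fun_space.subspace_0[OF TI_subspace])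
  then have "x \<in> direct_sum TI"
    using TI finite_subset[OF sub R] by (simp add: direct_sum_def x_def)
  moreover have "Phi x z = H z" for z
  proof -
    have "Phi x z = (\<Sum>r\<in>R. Psi r (T r) z)"
      unfolding Phi_superset[OF R sub] sum_fun_apply by (rule sum.cong) (simp_all add: x_def)
    also have "\<dots> = H z"
    proof (cases "z \<in> Mvar")
      case True
      have "(\<Sum>r\<in>R. Psi r (T r) z) = (\<Sum>e\<in>d ` R. h e z)"
        using T(2)[OF True] by (simp add: sum.reindex[OF inj_on_subset[OF d_inj]])
      also have "\<dots> = (\<Sum>e\<in>F. h e z)"
      proof (rule sum.mono_neutral_left[OF F])
        show "d ` R \<subseteq> F" by (auto simp: R_def)
        show "\<forall>e\<in>F - d ` R. h e z = 0"
        proof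
          fix e assume e: "e \<in> F - d ` R"
          have "\<exists>i. fst (e i) \<noteq> snd (e i) + 3"
          proof (rule ccontr)
            assume "\<not> ?thesis"
            then have "e = d (\<lambda>i. snd (e i))" by (simp add: d_def fun_eq_iff prod_eq_iff)
            with e show False unfolding R_def by (metis DiffD1 DiffD2 image_eqI mem_Collect_eq)
          qed
          then show "h e z = 0" using vanish[OF True] e by blast
        qed
      qed
      finally show ?thesis using Hp[OF True] ph by simp
    qed (simp add: T0 H0)
    finally show ?thesis .
  qed
  ultimately show thesis using that by blast
qed

lemma Phi_iso:
  "linear_iso (pointwise fscale) fscale (direct_sum (TI :: ('n::finite \<Rightarrow> nat) \<Rightarrow> _)) Wspace Phi"
  unfolding linear_iso_def
proof
  show lin: "linear_on (pointwise fscale) fscale (direct_sum (TI :: ('n \<Rightarrow> nat) \<Rightarrow> _)) Phi" by (rule Phi_linear)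
  show "bij_betw Phi (direct_sum (TI :: ('n \<Rightarrow> nat) \<Rightarrow> _)) Wspace"
    unfolding bij_betw_def
  proof
    show "inj_on Phi (direct_sum (TI :: ('n \<Rightarrow> nat) \<Rightarrow> _))"
    proof (rule inj_onI)
      fix x y :: "('n \<Rightarrow> nat) \<Rightarrow> ('n, 'v) tensor"
      assume x: "x \<in> direct_sum TI" and y: "y \<in> direct_sum TI" and eq: "Phi x = Phi y"
      have "finite ({r. x r \<noteq> 0} \<union> {r. y r \<noteq> 0})"
        using x y by (simp add: direct_sum_def)
      then have "finite {r. (x - y) r \<noteq> 0}"
        by (rule finite_subset[rotated]) auto
      moreover have "(x - y) r \<in> TI r" for r
      proof -
        have "x r - y r \<in> TI r"
          using x y by (intro fun_space.subspace_diff[OF TI_subspace]) (simp_all add: direct_sum_def)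
        then show ?thesis by simp
      qed
      ultimately have xy: "x - y \<in> direct_sum TI"
        unfolding direct_sum_def by blast
      have "Phi ((x - y) + y) = Phi (x - y) + Phi y"
        using lin xy y unfolding linear_on_def by blast
      with eq have "Phi (x - y) = 0" by (simp only: diff_add_cancel) simp
      with xy have "x - y = 0" by (rule Phi_injective)
      then show "x = y" by (rule eq_iff_diff_eq_0[THEN iffD2])
    qed
    show "Phi ` direct_sum (TI :: ('n \<Rightarrow> nat) \<Rightarrow> _) = Wspace"
    proof
      show "Phi ` direct_sum (TI :: ('n \<Rightarrow> nat) \<Rightarrow> _) \<subseteq> Wspace"
        using Phi_in_Wspace by blast
      show "Wspace \<subseteq> Phi ` direct_sum (TI :: ('n \<Rightarrow> nat) \<Rightarrow> _)"
      proof
        fix H :: "vec_covec^'n \<Rightarrow> complex" assume "H \<in> Wspace"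
        then show "H \<in> Phi ` direct_sum TI" by (rule Phi_surjective) blast
      qed
    qed
  qed
qed

end

text \<open>A bare linear isomorphism would only compare dimensions. Naturality is recorded by
  requiring that, on each summand, it be the multiplication map built from equivariant embeddings of
  the factors.\<close>

theorem theorem3p3:
  fixes sc :: "complex \<Rightarrow> 'v::ab_group_add \<Rightarrow> 'v"
    and V :: "nat \<Rightarrow> nat \<Rightarrow> 'v set"
    and \<rho> :: "nat \<Rightarrow> nat \<Rightarrow> complex^3^3 \<Rightarrow> 'v \<Rightarrow> 'v"
  assumes "vector_space sc"
    and "\<And>a b. irreducible_representation sc (V a b) (\<rho> a b)"
    and "\<And>a b. has_highest_weight sc (V a b) (\<rho> a b) a b"
  shows "\<exists>\<Phi> :: (('n::finite \<Rightarrow> nat) \<Rightarrow> ('n, 'v) tensor) \<Rightarrow> (vec_covec^'n \<Rightarrow> complex).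
      linear_iso (pointwise fscale) fscale
        (direct_sum (\<lambda>r. tensor_invariants sc (\<lambda>i. V (r i + 3) (r i)) (\<lambda>i. \<rho> (r i + 3) (r i))))
        Wspace \<Phi> \<and>
      (\<exists>\<phi> \<Psi>.
        (\<forall>k. equivariant_embedding sc (V (k + 3) k) (\<rho> (k + 3) k) (\<phi> k)) \<and>
        (\<forall>r. linear_on fscale fscale (tensor_product sc (\<lambda>i. V (r i + 3) (r i))) (\<Psi> r) \<and>
          (\<forall>v. (\<forall>i. v i \<in> V (r i + 3) (r i)) \<longrightarrow>
            \<Psi> r (pure_tensor sc (\<lambda>i. V (r i + 3) (r i)) v) =
              (\<lambda>z. \<Prod>i\<in>UNIV. \<phi> (r i) (v i) (z $ i))) \<and>
          (\<forall>T\<in>tensor_invariants sc (\<lambda>i. V (r i + 3) (r i)) (\<lambda>i. \<rho> (r i + 3) (r i)).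
            \<Phi> (0(r := T)) = \<Psi> r T)))"
proof -
  have "\<forall>k. \<exists>\<phi>. equivariant_embedding sc (V (k + 3) k) (\<rho> (k + 3) k) \<phi> \<and>
    \<phi> ` V (k + 3) k = fspan {flag_kernel (k + 3) k (pair_action h base_flag) | h. h \<in> SL3}"
  proof
    fix k
    obtain v where v: "v \<in> V (k + 3) k" "v \<noteq> 0" "\<forall>g\<in>borel_subgroup.
        \<rho> (k + 3) k g v = sc ((g $ 1 $ 1) ^ (k + 3) * (g $ 1 $ 1 * g $ 2 $ 2) ^ k) v"
      using assms(3)[of "k + 3" k] unfolding has_highest_weight_def by blast
    have "highest_weight_irrep sc (V (k + 3) k) (\<rho> (k + 3) k) (k + 3) k v"
      using assms(1,2) v by (simp add: highest_weight_irrep_def highest_weight_irrep_axioms_def)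
    then show "\<exists>\<phi>. equivariant_embedding sc (V (k + 3) k) (\<rho> (k + 3) k) \<phi> \<and>
      \<phi> ` V (k + 3) k = fspan {flag_kernel (k + 3) k (pair_action h base_flag) | h. h \<in> SL3}"
      by (rule highest_weight_irrep.embedding) blast
  qed
  then obtain \<phi> where \<phi>: "\<And>k. equivariant_embedding sc (V (k + 3) k) (\<rho> (k + 3) k) (\<phi> k)"
    "\<And>k. \<phi> k ` V (k + 3) k = fspan {flag_kernel (k + 3) k (pair_action h base_flag) | h. h \<in> SL3}"
    unfolding choice_iff by blast
  interpret vector_space sc by fact
  interpret embedded_family sc "\<lambda>k. V (k + 3) k" "\<lambda>k. \<rho> (k + 3) k" \<phi>
  proof unfold_locales
    show "SL3_representation sc (V (k + 3) k) (\<rho> (k + 3) k)" for k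
      using assms(2)[of "k + 3" k] unfolding irreducible_representation_def by (rule conjunct1)
  qed (rule \<phi>)+
  show ?thesis
    by (intro exI[of _ Phi] conjI exI[of _ \<phi>] exI[of _ Psi] allI ballI impI Phi_iso \<phi>(1))
      (simp_all add: Phi_single Psi_pure Psi_linear linear_on_def)
qed

end
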